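(* Let $n\ge 1$ be an integer and let $\tilde t=(t_0,t_1,\bar t_1,t_2,\bar t_2,\dots)$ be such that $t_i=\bar t_i=0$ for all $i>n$, $0<t_0<1$, and $|t_i|,|\bar t_i|\le (4n^3\,2^n e^n)^{-1}$ for $1\le i\le n$ (here $t_0$ is real and $t_i,\bar t_i$, $i\ge1$, are complex). Then the series $$F(\tilde t)=\frac12 t_0^2\log t_0-\frac34 t_0^2+\sum \frac{i_1^{n_1}\cdots i_k^{n_k}}{n_1!\cdots n_k!}\,\frac{\bar i_1^{\bar n_1}\cdots\bar i_{\bar k}^{\bar n_{\bar k}}}{\bar n_1!\cdots\bar n_{\bar k}!}\,N_i^2\left(\begin{matrix}i_1&\dots&i_k\\ n_1&\dots&n_k\end{matrix}\,\middle|\,\begin{matrix}\bar i_1&\dots&\bar i_{\bar k}\\ \bar n_1&\dots&\bar n_{\bar k}\end{matrix}\right) t_0^{\,i-(n_1+\dots+n_k+\bar n_1+\dots+\bar n_{\bar k})+2}\,t_{i_1}^{n_1}\cdots t_{i_k}^{n_k}\,\bar t_{\bar i_1}^{\bar n_1}\cdots\bar t_{\bar i_{\bar k}}^{\bar n_{\bar k}}$$ converges, where the sum is over all integers $i,k,\bar k\ge 1$, $n_r,\bar n_r\ge 1$, $0<i_1<\dots<i_k$, $0<\bar i_1<\dots<\bar i_{\bar k}$ satisfying $i-(n_1+\dots+n_k+\bar n_1+\dots+\bar n_{\bar k})+2\ge 0$, and the coefficients $N_i^2$ are those defined in the context.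
   Context: The series is the Taylor series of the string solution of the dispersionless limit of the 2D Toda hierarchy. Convergence of the sum over its (unordered) index set is understood as unconditional, i.e. absolute, convergence. All indices below are positive integers unless stated otherwise. (1) For $i+j=s_1+\dots+s_m$ let $P_{i,j}(s_1,\dots,s_m)$ be the number of integer tuples $(a_1,\dots,a_m)$ with $a_1+\dots+a_m=i$ and $1\le a_r\le s_r-1$ for all $r$. (2) For $i+j=s_1+\dots+s_m$ let $$T^1_{i,j}(s_1,\dots,s_m)=\sum_{\substack{k\ge 1,\ n_1+\dots+n_k=m\\ n_r\ge 1}}\frac{1}{k\,n_1!\cdots n_k!}\,P_{i,j}\big(s_1+\dots+s_{n_1},\ \dots,\ s_{n_1+\dots+n_{k-1}+1}+\dots+s_{n_1+\dots+n_k}\big),$$ where the $r$-th argument of $P_{i,j}$ is the sum of the $r$-th block of $n_r$ consecutive $s$'s. (3) For $k\ge 2$, $s_1+\dots+s_m=i_1+\dots+i_k$ and $l_1+\dots+l_m=m+k-2$ with all $s_r,l_r\ge 1$, define $T^2_{i_1,\dots,i_k}\left(\begin{matrix}s_1&\dots&s_m\\ l_1&\dots&l_m\end{matrix}\right)$ recursively. For $k=2$ (then all $l_r=1$), $T^2_{i_1,i_2}\left(\begin{matrix}s_1&\dots&s_m\\ 1&\dots&1\end{matrix}\right)=T^1_{i_1,i_2}(s_1,\dots,s_m)$. For $k\ge 3$, $$T^2_{i_1,\dots,i_k}\left(\begin{matrix}s_1&\dots&s_m\\ l_1&\dots&l_m\end{matrix}\right)=\sum l\;T^1_{s,i_k}(s_p,\dots,s_q)\;T^2_{i_1,\dots,i_{k-1}}\left(\begin{matrix}s_1&\dots&s_{p-1}&s&s_{q+1}&\dots&s_m\\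 l_1&\dots&l_{p-1}&l&l_{q+1}&\dots&l_m\end{matrix}\right),$$ where the sum is over all $1\le p\le q\le m$ such that $s:=s_p+\dots+s_q-i_k\ge 1$ and $l:=(l_p-1)+\dots+(l_q-1)\ge 1$. (4) Let $$S_{\bar i_1,\dots,\bar i_{\bar k}}\left(\begin{matrix}s_1&\dots&s_m\\ l_1&\dots&l_m\end{matrix}\right)=\sum\ \prod_{r=1}^m\frac{(s_r-1)!}{(s_r-n_r-l_r+1)!\,(l_r-1)!},$$ where the sum is over all ordered $m$-tuples $(B_1,\dots,B_m)$ of pairwise disjoint sets with union $\{1,\dots,\bar k\}$ (so the $\bar i_a$ are treated as labelled, even if equal) such that, with $n_r=|B_r|$, one has $\sum_{a\in B_r}\bar i_a=s_r$ and $s_r-n_r-l_r+1\ge 0$ for every $r$. (5) The numbers $N^1_i(i_1,\dots,i_k\mid\bar i_1,\dots,\bar i_{\bar k})$, $k,\bar k\ge 1$, are defined as follows. They are $0$ if $i\ne i_1+\dots+i_k$ or $i\ne\bar i_1+\dots+\bar i_{\bar k}$. Otherwise: $N^1_i(i\mid\bar i_1,\dots,\bar i_{\bar k})=\frac{(i-1)!}{(i-\bar k+1)!}$ (case $k=1$); $N^1_i(i_1,\dots,i_k\mid i)=\frac{(i-1)!}{(i-k+1)!}$ (case $\bar k=1$); and for $k,\bar k>1$ $$N^1_i(i_1,\dots,i_k\mid\bar i_1,\dots,\bar i_{\bar k})=\sum_{\substack{m\ge 1,\ s_r,l_r\ge 1\\ s_1+\dots+s_m=i_1+\dots+i_k\\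 l_1+\dots+l_m=m+k-2}}(-1)^{m+1}\,S_{\bar i_1,\dots,\bar i_{\bar k}}\left(\begin{matrix}s_1&\dots&s_m\\ l_1&\dots&l_m\end{matrix}\right)T^2_{i_1,\dots,i_k}\left(\begin{matrix}s_1&\dots&s_m\\ l_1&\dots&l_m\end{matrix}\right).$$ (6) For $0<i_1<\dots<i_k$, $0<\bar i_1<\dots<\bar i_{\bar k}$ and $n_r,\bar n_r\ge 1$, $$N_i^2\left(\begin{matrix}i_1&\dots&i_k\\ n_1&\dots&n_k\end{matrix}\,\middle|\,\begin{matrix}\bar i_1&\dots&\bar i_{\bar k}\\ \bar n_1&\dots&\bar n_{\bar k}\end{matrix}\right)=N_i^1\big(\underbrace{i_1,\dots,i_1}_{n_1},\dots,\underbrace{i_k,\dots,i_k}_{n_k}\,\big|\,\underbrace{\bar i_1,\dots,\bar i_1}_{\bar n_1},\dots,\underbrace{\bar i_{\bar k},\dots,\bar i_{\bar k}}_{\bar n_{\bar k}}\big).$$ *)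

theory Defs
  imports "HOL-Analysis.Analysis"
begin

text \<open>
  Finite sequences of indices are lists of natural numbers, and positions are counted from 0.
  A letter such as \<open>us\<close>, \<open>ss\<close>, \<open>ls\<close> denotes a list; \<open>vs\<close> and \<open>ms\<close> stand for the barred indices
  and the barred multiplicities. The recursive objects are defined for all arguments;
  they are meaningful only for positive entries that satisfy the stated sum conditions.
\<close>

definition pos_list :: "nat list \<Rightarrow> bool" where
  "pos_list xs \<longleftrightarrow> (\<forall>x\<in>set xs. 1 \<le> x)"

definition P_num :: "nat \<Rightarrow> nat \<Rightarrow> nat list \<Rightarrow> nat" where
  "P_num i j ss = card {xs. length xs = length ss \<and> sum_list xs = i \<and> i + j = sum_list ss \<and>
      (\<forall>r<length ss. 1 \<le> xs ! r \<and> xs ! r \<le> ss ! r - 1)}"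

fun block_sums :: "nat list \<Rightarrow> nat list \<Rightarrow> nat list" where
  "block_sums [] ss = []"
| "block_sums (n # ns) ss = sum_list (take n ss) # block_sums ns (drop n ss)"

definition T1 :: "nat \<Rightarrow> nat \<Rightarrow> nat list \<Rightarrow> real" where
  "T1 i j ss = (\<Sum>ns | ns \<noteq> [] \<and> pos_list ns \<and> sum_list ns = length ss.
      1 / (real (length ns) * (\<Prod>r<length ns. fact (ns ! r))) * real (P_num i j (block_sums ns ss)))"

text \<open>
  The two rows of \<open>T2\<close> are the lists \<open>ss\<close> and \<open>ls\<close>; the recursion removes the last of the
  indices \<open>us\<close>. The condition \<open>s \<ge> 1\<close> for the integer difference is
  \<open>last us < sum of the s-block\<close>, so that the truncated subtraction below is exact.
\<close>

function T2 :: "nat list \<Rightarrow> nat list \<Rightarrow> nat list \<Rightarrow> real" where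
  "T2 us ss ls =
    (if length us < 2 then 0
     else if length us = 2 then T1 (us ! 0) (us ! 1) ss
     else (\<Sum>(p, q) | p \<le> q \<and> q < length ss \<and>
              last us < (\<Sum>r=p..q. ss ! r) \<and> 1 \<le> (\<Sum>r=p..q. ls ! r - 1).
            let s = (\<Sum>r=p..q. ss ! r) - last us;
                l = (\<Sum>r=p..q. ls ! r - 1)
            in real l * T1 s (last us) (take (q + 1 - p) (drop p ss)) *
               T2 (butlast us) (take p ss @ s # drop (q + 1) ss) (take p ls @ l # drop (q + 1) ls)))"
  by pat_completeness auto
termination
  by (relation "Wellfounded.measure (\<lambda>(us, ss, ls). length us)") auto

declare T2.simps [simp del]

definition set_splits :: "nat \<Rightarrow> nat \<Rightarrow> nat set list set" where
  "set_splits m k = {Bs. length Bs = m \<and> \<Union>(set Bs) = {..<k} \<and>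
      (\<forall>r<m. \<forall>r'<m. r \<noteq> r' \<longrightarrow> Bs ! r \<inter> Bs ! r' = {})}"

text \<open>
  In the side condition of \<open>S_num\<close>, \<open>n_r + l_r \<le> s_r + 1\<close> is
  \<open>s_r - n_r - l_r + 1 \<ge> 0\<close> without truncated subtraction.
\<close>

definition S_num :: "nat list \<Rightarrow> nat list \<Rightarrow> nat list \<Rightarrow> real" where
  "S_num vs ss ls = (\<Sum>Bs | Bs \<in> set_splits (length ss) (length vs) \<and>
        (\<forall>r<length ss. (\<Sum>a\<in>Bs ! r. vs ! a) = ss ! r \<and> card (Bs ! r) + ls ! r \<le> ss ! r + 1).
      \<Prod>r<length ss. fact (ss ! r - 1) /
        (fact (ss ! r + 1 - (card (Bs ! r) + ls ! r)) * fact (ls ! r - 1)))"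

definition N1 :: "nat \<Rightarrow> nat list \<Rightarrow> nat list \<Rightarrow> real" where
  "N1 i us vs =
    (if i \<noteq> sum_list us \<or> i \<noteq> sum_list vs then 0
     else if length us = 1 then fact (i - 1) / fact (i + 1 - length vs)
     else if length vs = 1 then fact (i - 1) / fact (i + 1 - length us)
     else (\<Sum>(ss, ls) | ss \<noteq> [] \<and> length ls = length ss \<and> pos_list ss \<and> pos_list ls \<and>
              sum_list ss = sum_list us \<and> sum_list ls = length ss + length us - 2.
            (-1) ^ (length ss + 1) * S_num vs ss ls * T2 us ss ls))"

definition with_mult :: "nat list \<Rightarrow> nat list \<Rightarrow> nat list" where
  "with_mult us ns = concat (map2 (\<lambda>i n. replicate n i) us ns)"

definition N2 :: "nat \<Rightarrow> nat list \<Rightarrow> nat list \<Rightarrow> nat list \<Rightarrow> nat list \<Rightarrow> real" where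
  "N2 i us ns vs ms = N1 i (with_mult us ns) (with_mult vs ms)"

definition toda_index :: "(nat \<times> nat list \<times> nat list \<times> nat list \<times> nat list) set" where
  "toda_index = {(i, us, ns, vs, ms). 1 \<le> i \<and>
      us \<noteq> [] \<and> sorted_wrt (<) us \<and> pos_list us \<and> length ns = length us \<and> pos_list ns \<and>
      vs \<noteq> [] \<and> sorted_wrt (<) vs \<and> pos_list vs \<and> length ms = length vs \<and> pos_list ms \<and>
      sum_list ns + sum_list ms \<le> i + 2}"

definition toda_term :: "real \<Rightarrow> (nat \<Rightarrow> complex) \<Rightarrow> (nat \<Rightarrow> complex) \<Rightarrow>
    nat \<times> nat list \<times> nat list \<times> nat list \<times> nat list \<Rightarrow> complex" where
  "toda_term t0 t tb = (\<lambda>(i, us, ns, vs, ms).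
      (\<Prod>r<length us. of_nat (us ! r) ^ (ns ! r) / fact (ns ! r)) *
      (\<Prod>r<length vs. of_nat (vs ! r) ^ (ms ! r) / fact (ms ! r)) *
      of_real (N2 i us ns vs ms) *
      of_real t0 ^ (i + 2 - (sum_list ns + sum_list ms)) *
      (\<Prod>r<length us. t (us ! r) ^ (ns ! r)) *
      (\<Prod>r<length vs. tb (vs ! r) ^ (ms ! r)))"

text \<open>
  \<open>F\<close> is the value of the series. Since \<open>has_sum\<close> is convergence along the net of finite subsets,
  it is unconditional convergence, which for complex terms is equivalent to absolute convergence
  (\<open>summable_on_iff_abs_summable_on_complex\<close>).
\<close>

definition toda_series_has_value :: "real \<Rightarrow> (nat \<Rightarrow> complex) \<Rightarrow> (nat \<Rightarrow> complex) \<Rightarrow> complex \<Rightarrow> bool" where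
  "toda_series_has_value t0 t tb F \<longleftrightarrow>
    (\<exists>R. (toda_term t0 t tb has_sum R) toda_index \<and>
         F = of_real (1 / 2 * t0\<^sup>2 * ln t0 - 3 / 4 * t0\<^sup>2) + R)"

end

theory Submission
  imports Defs
begin

text \<open>
  All indices that occur in a nonzero term are at most \<open>n\<close>. Let \<open>K\<close> and \<open>K'\<close> be the numbers of unbarred
  and of barred indices, counted with multiplicity. The series converges because the coefficients
  satisfy

    \<open>\<bar>N1\<bar> \<le> K! * (n * (2 * e) ^ n) ^ K * K'! * (2 * (2 * e) ^ n) ^ K'\<close>  (lemma \<open>abs_N1_le\<close>).

  Indeed, the factorials combine with the factors \<open>1 / n\<^sub>r!\<close> of the term to multinomial
  coefficients, and a prefactor \<open>i\<close> times a variable is at most \<open>n * (4 * n ^ 3 * (2 * e) ^ n) ^ (-1)\<close> in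
  norm, so that what is left of the exponential factors is at most \<open>(1 / (2 * n)) ^ (K + K')\<close>. The
  multinomial coefficients of \<open>K\<close> for \<open>d \<le> n\<close> different indices add up to \<open>d ^ K\<close>. So the series is
  dominated by finitely many copies of a product of two geometric series of ratio \<open>1 / 2\<close>. The
  remaining summation index \<open>i\<close> is the common sum of the unbarred and of the barred indices, and the
  power of \<open>t0\<close> is at most 1.

  The bound for \<open>N1\<close> comes from its definition as a signed sum of products \<open>S * T2\<close> over two-rowed
  arrays. Cancellation between the signs is not exploited.

  First, \<open>T2\<close> is bounded uniformly over all arrays by \<open>(K - 2)! * (n * (2 * e) ^ n) ^ (K - 1)\<close> (lemma
  \<open>T2_bounds\<close>). This rests on \<open>T1 \<le> 2 ^ (j - 1) * j ^ N / N!\<close> for \<open>N\<close> entries (lemma \<open>T1_le\<close>): the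
  factorial in the denominator makes the sum over all intervals of columns in the recursion converge,
  at the cost of \<open>(2 * e) ^ j\<close> up to a factor \<open>j\<close>, and the weights \<open>l\<close> in the recursion produce
  \<open>(K - 2)!\<close>.

  Second, the sum of \<open>S\<close> over all arrays is at most \<open>3 ^ i * K'! * 2 ^ K'\<close> (lemma \<open>sum_S_num_le\<close>): it is a
  sum over ordered set partitions of the barred indices, in which every block of size \<open>c\<close> and sum \<open>s\<close>
  carries a weight of at most \<open>3 ^ s * c!\<close>, and there are at most \<open>K'! * 2 ^ K'\<close> ordered set partitions
  with linearly ordered blocks.
\<close>

section \<open>Sums over multiplicities\<close>

lemma finite_lists_sum_eq: "finite {ns :: nat list. length ns = k \<and> sum_list ns = N}"
proof (rule finite_subset)
  show "{ns :: nat list. length ns = k \<and> sum_list ns = N} \<subseteq> {ns. set ns \<subseteq> {..N} \<and> length ns = k}"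
    using member_le_sum_list by fastforce
qed (simp add: finite_lists_length_eq)

text \<open>
  Both sides are the coefficient of \<open>x ^ N\<close> in \<open>exp (k * x)\<close>, on the left written as a product of
  \<open>k\<close> exponential series. The identity is used twice: for the block lengths in \<open>T1\<close>, and for the
  multiplicities in the final series.
\<close>

lemma multinomial_exponential_sum:
  "(\<Sum>ns | length ns = k \<and> sum_list ns = N. \<Prod>r<k. 1 / fact (ns ! r)) = (real k ^ N / fact N :: real)"
proof (induction k arbitrary: N)
  case 0
  have "{ns :: nat list. ns = [] \<and> sum_list ns = N} = (if N = 0 then {[]} else {})" by auto
  then show ?case by (simp add: power_0_left)
next
  case (Suc k)
  let ?A = "\<lambda>k N. {ns :: nat list. length ns = k \<and> sum_list ns = N}"
  have "(\<Sum>ns\<in>?A (Suc k) N. \<Prod>r<Suc k. 1 / fact (ns ! r) :: real) =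
      (\<Sum>(a, ns)\<in>(SIGMA a:{..N}. ?A k (N - a)). \<Prod>r<Suc k. 1 / fact ((a # ns) ! r))"
    by (rule sum.reindex_bij_witness[where i = "\<lambda>(a, ns). a # ns" and j = "\<lambda>ns. (hd ns, tl ns)"])
       (auto simp: length_Suc_conv)
  also have "\<dots> = (\<Sum>a\<le>N. \<Sum>ns\<in>?A k (N - a). (1 / fact a) * (\<Prod>r<k. 1 / fact (ns ! r)))"
    by (subst sum.Sigma[symmetric]) (auto simp: finite_lists_sum_eq prod.lessThan_Suc_shift simp del: prod.lessThan_Suc)
  also have "\<dots> = (\<Sum>a\<le>N. (1 / fact a) * (real k ^ (N - a) / fact (N - a)))"
    by (simp only: sum_distrib_left[symmetric] Suc.IH)
  also have "\<dots> = (\<Sum>a\<le>N. real (N choose a) * real k ^ (N - a) / fact N)"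
    by (intro sum.cong refl) (simp add: binomial_fact)
  also have "\<dots> = real (Suc k) ^ N / fact N"
    using binomial_ring[of 1 "real k" N] by (simp add: sum_divide_distrib[symmetric] algebra_simps)
  finally show ?case by simp
qed

section \<open>The numbers $P$ and $T^1$\<close>

text \<open>
  The complementary parts \<open>s\<^sub>r - a\<^sub>r\<close> of a tuple counted by \<open>P_num\<close> form a composition of \<open>j\<close> into
  positive parts, and they determine the tuple. What matters is that the bound does not depend on
  the sizes of the \<open>s\<^sub>r\<close>, nor on \<open>i\<close>.
\<close>

lemma P_num_le_choose:
  assumes "ss \<noteq> []" "1 \<le> j"
  shows "P_num i j ss \<le> (j - 1) choose (length ss - 1)"
proof -
  let ?m = "length ss"
  let ?X = "{xs. length xs = length ss \<and> sum_list xs = i \<and> i + j = sum_list ss \<and>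
      (\<forall>r<length ss. 1 \<le> xs ! r \<and> xs ! r \<le> ss ! r - 1)}"
  let ?Y = "{bs :: nat list. length bs = ?m \<and> sum_list bs = j - ?m}"
  let ?f = "\<lambda>xs. map (\<lambda>r. ss ! r - xs ! r - 1) [0..<?m]"
  have pos: "?m > 0" using assms by simp
  have key: "sum_list (?f xs) + ?m = j" if "xs \<in> ?X" for xs
  proof -
    have "sum_list (?f xs) + ?m = (\<Sum>r<?m. ss ! r - xs ! r - 1) + (\<Sum>r<?m. 1)"
      by (simp add: sum_list_distinct_conv_sum_set atLeast0LessThan)
    also have "\<dots> = (\<Sum>r<?m. ss ! r - xs ! r)"
      unfolding sum.distrib[symmetric] using that by (intro sum.cong) fastforce+
    finally have "sum_list (?f xs) + ?m + sum_list xs = (\<Sum>r<?m. ss ! r - xs ! r) + (\<Sum>r<?m. xs ! r)"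
      using that by (simp add: sum_list_sum_nth atLeast0LessThan)
    also have "\<dots> = (\<Sum>r<?m. ss ! r)"
      unfolding sum.distrib[symmetric] using that by (intro sum.cong) fastforce+
    also have "\<dots> = i + j" using that by (simp add: sum_list_sum_nth atLeast0LessThan)
    finally show ?thesis using that by simp
  qed
  have inj: "inj_on ?f ?X"
  proof (rule inj_onI)
    fix xs ys assume a: "xs \<in> ?X" "ys \<in> ?X" "?f xs = ?f ys"
    show "xs = ys"
    proof (rule nth_equalityI)
      fix r assume r: "r < length xs"
      with a have r': "r < ?m" by simp
      have "?f xs ! r = ?f ys ! r" by (simp only: a(3))
      moreover have "1 \<le> xs ! r" "xs ! r \<le> ss ! r - 1" "1 \<le> ys ! r" "ys ! r \<le> ss ! r - 1" using a r' by auto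
      ultimately show "xs ! r = ys ! r" using r' by simp
    qed (use a in simp)
  qed
  show ?thesis
  proof (cases "?m \<le> j")
    case True
    have "?f ` ?X \<subseteq> ?Y" using key by fastforce
    then have "P_num i j ss \<le> card ?Y"
      unfolding P_num_def by (rule card_inj_on_le[OF inj _ finite_lists_sum_eq])
    also have "\<dots> = (j - ?m + ?m - 1) choose (j - ?m)" by (simp add: card_length_sum_list)
    also have "\<dots> = (j - 1) choose (?m - 1)"
      using True pos by (subst binomial_symmetric) auto
    finally show ?thesis .
  next
    case False
    then have "?X = {}" using key by fastforce
    then have "P_num i j ss = 0" by (simp only: P_num_def card.empty)
    then show ?thesis by simp
  qed
qed

lemma length_block_sums [simp]: "length (block_sums ns ss) = length ns"
  by (induction ns ss rule: block_sums.induct) auto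

lemma T1_nonneg: "0 \<le> T1 i j ss"
  unfolding T1_def by (intro sum_nonneg mult_nonneg_nonneg divide_nonneg_nonneg) (auto intro!: prod_nonneg mult_nonneg_nonneg)

text \<open>
  At most \<open>j\<close> blocks contribute, since a composition of \<open>j\<close> has at most \<open>j\<close> parts. For \<open>k\<close> blocks the
  weights \<open>1 / n\<^sub>r!\<close> add up to at most \<open>k ^ N / N!\<close>, hence to at most \<open>j ^ N / N!\<close>, and the binomial
  bounds for \<open>P_num\<close> add up to at most \<open>2 ^ (j - 1)\<close>. The decay in the number \<open>N\<close> of entries is what
  later makes the sum over all intervals in the recursion for \<open>T2\<close> bounded independently of the
  number of columns.
\<close>

lemma T1_le:
  assumes "1 \<le> j"
  shows "T1 i j ss \<le> 2 ^ (j - 1) * (real j ^ length ss / fact (length ss))"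
proof -
  let ?N = "length ss"
  let ?C = "{ns. ns \<noteq> [] \<and> pos_list ns \<and> sum_list ns = ?N}"
  let ?A = "\<lambda>k. {ns :: nat list. length ns = k \<and> sum_list ns = ?N}"
  let ?w = "\<lambda>ns :: nat list. real ((j - 1) choose (length ns - 1)) * (\<Prod>r<length ns. 1 / fact (ns ! r))"
  have len: "length ns \<le> ?N" if "ns \<in> ?C" for ns
  proof -
    have "sum_list (map (\<lambda>_. 1) ns) \<le> sum_list (map (\<lambda>x. x) ns)"
      using that by (intro sum_list_mono) (auto simp: pos_list_def)
    then show ?thesis using that by (simp add: sum_list_triv)
  qed
  have sub: "?C \<subseteq> (\<Union>k\<in>{1..?N}. ?A k)"
    using len by (auto simp: Suc_le_eq)
  have fin: "finite (\<Union>k\<in>{1..?N}. ?A k)" by (auto simp: finite_lists_sum_eq)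
  have "T1 i j ss \<le> (\<Sum>ns\<in>?C. ?w ns)"
    unfolding T1_def
  proof (intro sum_mono)
    fix ns assume ns: "ns \<in> ?C"
    then have l: "1 \<le> length ns" by (cases ns) auto
    have p: "0 \<le> (\<Prod>r<length ns. 1 / fact (ns ! r) :: real)" by (intro prod_nonneg) auto
    have "1 / (real (length ns) * (\<Prod>r<length ns. fact (ns ! r))) * real (P_num i j (block_sums ns ss))
        = (\<Prod>r<length ns. 1 / fact (ns ! r)) * (real (P_num i j (block_sums ns ss)) / length ns)"
      by (simp add: prod_dividef)
    also have "\<dots> \<le> (\<Prod>r<length ns. 1 / fact (ns ! r)) * real ((j - 1) choose (length ns - 1))"
    proof (intro mult_left_mono p)
      have "real (P_num i j (block_sums ns ss)) / length ns \<le> real (P_num i j (block_sums ns ss))"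
        using l mult_left_mono[of 1 "real (length ns)" "real (P_num i j (block_sums ns ss))"]
        by (simp add: divide_le_eq)
      also have "block_sums ns ss \<noteq> []" using l length_block_sums[of ns ss] by fastforce
      then have "real (P_num i j (block_sums ns ss)) \<le> real ((j - 1) choose (length ns - 1))"
        using P_num_le_choose[of "block_sums ns ss" j i] assms by simp
      finally show "real (P_num i j (block_sums ns ss)) / length ns \<le> real ((j - 1) choose (length ns - 1))" .
    qed
    finally show "1 / (real (length ns) * (\<Prod>r<length ns. fact (ns ! r))) * real (P_num i j (block_sums ns ss)) \<le> ?w ns"
      by (simp add: mult.commute)
  qed
  also have "\<dots> \<le> (\<Sum>ns\<in>(\<Union>k\<in>{1..?N}. ?A k). ?w ns)"
    by (rule sum_mono2[OF fin sub]) (auto intro!: mult_nonneg_nonneg prod_nonneg)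
  also have "\<dots> = (\<Sum>k=1..?N. \<Sum>ns\<in>?A k. ?w ns)"
    by (rule sum.UNION_disjoint) (auto simp: finite_lists_sum_eq)
  also have "\<dots> = (\<Sum>k=1..?N. real ((j - 1) choose (k - 1)) * (real k ^ ?N / fact ?N))"
    by (intro sum.cong refl) (simp add: sum_distrib_left[symmetric] multinomial_exponential_sum[symmetric])
  also have "\<dots> \<le> (\<Sum>k=1..?N. real ((j - 1) choose (k - 1)) * (real j ^ ?N / fact ?N))"
  proof (intro sum_mono)
    \<comment> \<open>beyond \<open>k = j\<close> the binomial coefficient vanishes, so \<open>k\<close> may be replaced by \<open>j\<close>\<close>
    fix k assume "k \<in> {1..?N}"
    show "real ((j - 1) choose (k - 1)) * (real k ^ ?N / fact ?N) \<le> real ((j - 1) choose (k - 1)) * (real j ^ ?N / fact ?N)"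
    proof (cases "k \<le> j")
      case True
      then show ?thesis by (intro mult_left_mono divide_right_mono power_mono) auto
    next
      case False
      then have "(j - 1) choose (k - 1) = 0" using assms by (intro binomial_eq_0) auto
      then show ?thesis by (simp only: of_nat_0 mult_zero_left order_refl)
    qed
  qed
  also have "\<dots> = real (\<Sum>k=1..?N. (j - 1) choose (k - 1)) * (real j ^ ?N / fact ?N)"
    by (simp add: sum_distrib_right sum_divide_distrib)
  also have "\<dots> \<le> 2 ^ (j - 1) * (real j ^ ?N / fact ?N)"
  proof (rule mult_right_mono)
    have "(\<Sum>k=1..?N. (j - 1) choose (k - 1)) = (\<Sum>k<?N. (j - 1) choose k)"
      by (rule sum.reindex_bij_witness[where i = Suc and j = "\<lambda>k. k - 1"]) auto
    also have "\<dots> = (\<Sum>k\<in>{..<?N} \<inter> {..j - 1}. (j - 1) choose k)"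
      by (rule sum.mono_neutral_right) auto
    also have "\<dots> \<le> (\<Sum>k\<le>j - 1. (j - 1) choose k)"
      by (rule sum_mono2) auto
    also have "\<dots> = 2 ^ (j - 1)" by (rule choose_row_sum)
    finally show "real (\<Sum>k=1..?N. (j - 1) choose (k - 1)) \<le> 2 ^ (j - 1)"
      by (metis of_nat_le_iff of_nat_numeral of_nat_power)
  qed simp
  finally show ?thesis .
qed

section \<open>The numbers $T^2$\<close>

text \<open>
  After exchanging the sums, a position \<open>r\<close> lies in at most \<open>N\<close> intervals of length \<open>N\<close>: such an
  interval is determined by the offset of \<open>r\<close> in it.
\<close>

lemma sum_subintervals_le:
  fixes x :: "nat \<Rightarrow> real" and g :: "nat \<Rightarrow> real"
  assumes x: "\<And>r. 0 \<le> x r" and g: "\<And>N. 0 \<le> g N"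
  shows "(\<Sum>(p, q) | p \<le> q \<and> q < m. (\<Sum>r=p..q. x r) * g (q + 1 - p))
      \<le> (\<Sum>r<m. x r) * (\<Sum>N=1..m. real N * g N)"
proof -
  let ?I = "{(p, q). p \<le> q \<and> q < m}"
  have fI: "finite ?I" by (rule finite_subset[of _ "{..m} \<times> {..m}"]) auto
  have "(\<Sum>(p, q)\<in>?I. (\<Sum>r=p..q. x r) * g (q + 1 - p))
      = (\<Sum>z\<in>?I. \<Sum>r<m. if fst z \<le> r \<and> r \<le> snd z then x r * g (snd z + 1 - fst z) else 0)"
  proof (intro sum.cong refl, clarify)
    fix p q assume "p \<le> q" "q < m"
    then have "{..<m} \<inter> {r. p \<le> r \<and> r \<le> q} = {p..q}" by auto
    then show "(\<Sum>r=p..q. x r) * g (q + 1 - p) =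
        (\<Sum>r<m. if fst (p, q) \<le> r \<and> r \<le> snd (p, q) then x r * g (snd (p, q) + 1 - fst (p, q)) else 0)"
      by (simp add: sum.If_cases sum_distrib_right)
  qed
  also have "\<dots> = (\<Sum>r<m. x r * (\<Sum>z\<in>{z\<in>?I. fst z \<le> r \<and> r \<le> snd z}. g (snd z + 1 - fst z)))"
    by (subst sum.swap) (simp only: sum_distrib_left sum.inter_filter[OF fI] mult_zero_right if_distrib[of "(*) _"])
  also have "\<dots> \<le> (\<Sum>r<m. x r * (\<Sum>N=1..m. real N * g N))"
  proof (intro sum_mono mult_left_mono x)
    fix r assume r: "r \<in> {..<m}"
    let ?J = "{z\<in>?I. fst z \<le> r \<and> r \<le> snd z}" and ?D = "SIGMA N:{1..m}. {..<N}"
    let ?h = "\<lambda>(p, q). (q + 1 - p, r - p)"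
    have inj: "inj_on ?h ?J" by (auto simp: inj_on_def)
    have "(\<Sum>z\<in>?J. g (snd z + 1 - fst z)) = (\<Sum>z\<in>?h ` ?J. g (fst z))"
      by (subst sum.reindex[OF inj]) (auto intro!: sum.cong)
    also have "\<dots> \<le> (\<Sum>z\<in>?D. g (fst z))"
      by (rule sum_mono2) (use g in auto)
    also have "\<dots> = (\<Sum>N=1..m. \<Sum>k<N. g N)"
      by (subst sum.Sigma) (auto simp: case_prod_unfold)
    finally show "(\<Sum>z\<in>?J. g (snd z + 1 - fst z)) \<le> (\<Sum>N=1..m. real N * g N)" by simp
  qed
  finally show ?thesis by (simp add: sum_distrib_right)
qed

lemma sum_weighted_exp_terms_le: "(\<Sum>N=1..m. real N * (real j ^ N / fact N)) \<le> real j * exp (real j)"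
proof -
  have "(\<Sum>N=1..m. real N * (real j ^ N / fact N)) = (\<Sum>N<m. real j * (real j ^ N / fact N))"
    by (rule sum.reindex_bij_witness[where i = Suc and j = "\<lambda>k. k - 1"])
       (auto simp: field_simps fact_reduce power_eq_if)
  also have "\<dots> = real j * (\<Sum>N<m. real j ^ N /\<^sub>R fact N)"
    by (simp add: sum_distrib_left divide_inverse mult_ac)
  also have "\<dots> \<le> real j * exp (real j)"
    unfolding exp_def
    by (intro mult_left_mono sum_le_suminf summable_exp_generic) auto
  finally show ?thesis .
qed

text \<open>
  The bound is uniform in both rows of the array. One step of the recursion sums \<open>l * T1\<close> over all
  intervals of columns, where \<open>l\<close> is the sum of the numbers \<open>l\<^sub>r - 1\<close> over the interval. Hence, by the
  two preceding lemmas and \<open>T1_le\<close>, it contributes at most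
  \<open>(\<Sum>\<^sub>r (l\<^sub>r - 1)) * 2 ^ j * j * exp j\<close>, with \<open>j\<close> the index that is removed. The total
  \<open>\<Sum>\<^sub>r (l\<^sub>r - 1) = k - 2\<close> drops by exactly one together with \<open>k\<close>, so that these totals multiply up to
  \<open>(k - 2)!\<close>. The other factors are at most \<open>n * (2 * e) ^ n\<close> each.
\<close>

lemma T2_bounds:
  fixes n :: nat
  defines "B \<equiv> real n * (2 * exp 1) ^ n"
  assumes "2 \<le> length us" "\<And>u. u \<in> set us \<Longrightarrow> 1 \<le> u \<and> u \<le> n" "length ls = length ss"
    and "(\<Sum>r<length ss. ls ! r - 1) = length us - 2"
  shows "0 \<le> T2 us ss ls \<and> T2 us ss ls \<le> fact (length us - 2) * B ^ (length us - 1)"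
  using assms(2-)
proof (induction us ss ls rule: T2.induct)
  case (1 us ss ls)
  define j where "j = last us"
  have us: "us \<noteq> []" using 1(2) by auto
  have j: "1 \<le> j" "j \<le> n" using 1(3)[of "last us"] us by (auto simp: j_def)
  let ?m = "length ss"
  have B0: "0 \<le> B" by (simp add: B_def)
  have jB: "real j * (2 * exp 1) ^ j \<le> B"
    unfolding B_def using j exp_ge_add_one_self[of 1]
    by (intro mult_mono power_increasing) (auto intro: order_trans)
  have ej: "exp (real j) = exp 1 ^ j" by (simp add: exp_of_nat_mult[symmetric])
  have two: "(2::real) ^ (j - 1) \<le> 2 ^ j" by (intro power_increasing) auto
  show ?case
  proof (cases "length us = 2")
    case True
    then have "us ! 1 = j" by (simp add: j_def last_conv_nth us)
    then have T: "T2 us ss ls = T1 (us ! 0) j ss" using True by (simp add: T2.simps)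
    have "(\<Sum>N\<in>{?m}. real j ^ N /\<^sub>R fact N) \<le> exp (real j)"
      unfolding exp_def by (intro sum_le_suminf summable_exp_generic) auto
    then have "real j ^ ?m / fact ?m \<le> exp (real j)" by (simp add: divide_inverse mult.commute)
    then have "T2 us ss ls \<le> 2 ^ j * exp 1 ^ j"
      unfolding T using two by (intro order_trans[OF T1_le[OF j(1)]] mult_mono) (auto simp: ej)
    also have "\<dots> \<le> real j * (2 * exp 1) ^ j" using j by (simp add: power_mult_distrib)
    finally show ?thesis using jB True T by (simp add: T1_nonneg)
  next
    case False
    let ?k = "length us"
    have k: "3 \<le> ?k" using False 1(2) by simp
    let ?I = "{(p, q). p \<le> q \<and> q < ?m \<and> last us < (\<Sum>r=p..q. ss ! r) \<and> 1 \<le> (\<Sum>r=p..q. ls ! r - 1)}"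
    let ?s = "\<lambda>p q. (\<Sum>r=p..q. ss ! r) - last us" and ?l = "\<lambda>p q. \<Sum>r=p..q. ls ! r - 1"
    let ?R = "\<lambda>p q. T2 (butlast us) (take p ss @ ?s p q # drop (q + 1) ss) (take p ls @ ?l p q # drop (q + 1) ls)"
    let ?M = "fact (?k - 3) * B ^ (?k - 2)"
    let ?g = "\<lambda>N. 2 ^ (j - 1) * (real j ^ N / fact N)"
    have fI: "finite {(p, q). p \<le> q \<and> q < ?m}"
      by (rule finite_subset[of _ "{..?m} \<times> {..?m}"]) auto
    have sub: "?I \<subseteq> {(p, q). p \<le> q \<and> q < ?m}" by auto
    have T: "T2 us ss ls = (\<Sum>(p, q)\<in>?I. real (?l p q) *
        T1 (?s p q) j (take (q + 1 - p) (drop p ss)) * ?R p q)"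
      using k by (subst T2.simps) (simp add: Let_def j_def)
    \<comment> \<open>the contracted array satisfies the same hypotheses with one index less\<close>
    have R: "0 \<le> ?R p q \<and> ?R p q \<le> ?M" if "(p, q) \<in> ?I" for p q
    proof -
      let ?ss = "take p ss @ ?s p q # drop (q + 1) ss" and ?ls = "take p ls @ ?l p q # drop (q + 1) ls"
      have pq: "p \<le> q" "q < ?m" "1 \<le> ?l p q" using that unfolding mem_Collect_eq prod.case by blast+
      have len: "length ?ls = length ?ss" using 1(4) by simp
      have lsum: "(\<Sum>r<length xs. xs ! r - 1) = sum_list (map (\<lambda>x. x - 1) xs)" for xs :: "nat list"
        by (simp add: sum_list_sum_nth atLeast0LessThan)
      have "sum_list (map (\<lambda>x. x - 1) ls) = (\<Sum>r<?m. ls ! r - 1)" using lsum[of ls] 1(4) by simp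
      also have "\<dots> = (\<Sum>r<p. ls ! r - 1) + ?l p q + (\<Sum>r=q+1..<?m. ls ! r - 1)"
        using pq sum.atLeastLessThan_concat[of 0 p "q + 1" "\<lambda>r. ls ! r - 1"]
          sum.atLeastLessThan_concat[of 0 "q + 1" ?m "\<lambda>r. ls ! r - 1"]
        by (simp add: atLeast0LessThan atLeastLessThanSuc_atLeastAtMost)
      also have "(\<Sum>r<p. ls ! r - 1) = sum_list (map (\<lambda>x. x - 1) (take p ls))"
        unfolding lsum[symmetric] using pq 1(4) by (simp add: min_def)
      also have "(\<Sum>r=q+1..<?m. ls ! r - 1) = sum_list (map (\<lambda>x. x - 1) (drop (q+1) ls))"
        unfolding lsum[symmetric] using pq 1(4) by simp
          (rule sum.reindex_bij_witness[where i = "\<lambda>r. r + (q + 1)" and j = "\<lambda>r. r - (q + 1)"], auto simp: add.commute)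
      finally have "sum_list (map (\<lambda>x. x - 1) ?ls) = sum_list (map (\<lambda>x. x - 1) ls) - 1"
        using pq(3) by simp
      also have "\<dots> = ?k - 3"
        using 1(5) lsum[of ls] 1(4) by simp
      finally have total: "(\<Sum>r<length ?ss. ?ls ! r - 1) = ?k - 3"
        unfolding len[symmetric] lsum .
      have "0 \<le> ?R p q \<and> ?R p q \<le> fact (length (butlast us) - 2) * B ^ (length (butlast us) - 1)"
      proof (rule 1(1)[of "(p, q)" p q "?s p q" "?l p q"])
        show "\<not> ?k < 2" "?k \<noteq> 2" "2 \<le> length (butlast us)" using k by auto
        show "(p, q) \<in> ?I" by (fact that)
        show "1 \<le> u \<and> u \<le> n" if "u \<in> set (butlast us)" for u
          using 1(3) in_set_butlastD[OF that] by blast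
        show "length ?ls = length ?ss" by (fact len)
        show "(\<Sum>r<length ?ss. ?ls ! r - 1) = length (butlast us) - 2" using total k by simp
      qed (rule refl)+
      then show ?thesis by (simp add: numeral_eq_Suc)
    qed
    have M0: "0 \<le> ?M" using B0 by simp
    have "T2 us ss ls \<le> (\<Sum>(p, q)\<in>?I. real (?l p q) * ?g (q + 1 - p) * ?M)"
      unfolding T
    proof (intro sum_mono, clarify)
      fix p q assume pq: "p \<le> q" "q < ?m" "last us < (\<Sum>r=p..q. ss ! r)" "1 \<le> ?l p q"
      have "length (take (q + 1 - p) (drop p ss)) = q + 1 - p" using pq by simp
      then have "T1 (?s p q) j (take (q + 1 - p) (drop p ss)) \<le> ?g (q + 1 - p)"
        by (metis T1_le[OF j(1)])
      moreover have "0 \<le> ?R p q" "?R p q \<le> ?M" using R[of p q] pq by blast+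
      ultimately have "T1 (?s p q) j (take (q + 1 - p) (drop p ss)) * ?R p q \<le> ?g (q + 1 - p) * ?M"
        by (intro mult_mono) simp_all
      then show "real (?l p q) * T1 (?s p q) j (take (q + 1 - p) (drop p ss)) * ?R p q
          \<le> real (?l p q) * ?g (q + 1 - p) * ?M"
        unfolding mult.assoc by (rule mult_left_mono) (rule of_nat_0_le_iff)
    qed
    also have "\<dots> \<le> (\<Sum>(p, q) | p \<le> q \<and> q < ?m. real (?l p q) * ?g (q + 1 - p) * ?M)"
      using B0 by (intro sum_mono2[OF fI sub]) (auto intro!: mult_nonneg_nonneg sum_nonneg divide_nonneg_nonneg simp del: of_nat_sum)
    also have "\<dots> = (\<Sum>(p, q) | p \<le> q \<and> q < ?m. (\<Sum>r=p..q. real (ls ! r - 1)) * ?g (q + 1 - p)) * ?M"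
      by (simp add: sum_distrib_right case_prod_unfold)
    also have "\<dots> \<le> ((\<Sum>r<?m. real (ls ! r - 1)) * (\<Sum>N=1..?m. real N * ?g N)) * ?M"
      by (intro mult_right_mono sum_subintervals_le M0) auto
    also have "(\<Sum>r<?m. real (ls ! r - 1)) = real (?k - 2)"
      using 1(5) by (metis of_nat_sum)
    also have "(\<Sum>N=1..?m. real N * ?g N) = 2 ^ (j - 1) * (\<Sum>N=1..?m. real N * (real j ^ N / fact N))"
      by (simp add: sum_distrib_left mult_ac)
    also have "(real (?k - 2) * (2 ^ (j - 1) * (\<Sum>N=1..?m. real N * (real j ^ N / fact N)))) * ?M
        \<le> (real (?k - 2) * B) * ?M"
    proof (intro mult_right_mono[OF _ M0] mult_left_mono)
      have "2 ^ (j - 1) * (\<Sum>N=1..?m. real N * (real j ^ N / fact N)) \<le> 2 ^ j * (real j * exp (real j))"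
        using two by (intro mult_mono sum_weighted_exp_terms_le sum_nonneg) auto
      also have "\<dots> \<le> B" using jB by (simp add: ej power_mult_distrib mult_ac)
      finally show "2 ^ (j - 1) * (\<Sum>N=1..?m. real N * (real j ^ N / fact N)) \<le> B" .
    qed auto
    also have "\<dots> = fact (?k - 2) * B ^ (?k - 1)"
    proof -
      have "fact (?k - 2) = real (?k - 2) * fact (?k - 3)"
        using k fact_reduce[of "?k - 2", where 'a = real] by simp
      moreover have "B ^ (?k - 1) = B * B ^ (?k - 2)"
        using k by (subst power_Suc[symmetric], intro arg_cong[where f = "power B"]) simp
      ultimately show ?thesis by (simp only: mult_ac)
    qed
    finally have "T2 us ss ls \<le> fact (?k - 2) * B ^ (?k - 1)" .
    moreover have "0 \<le> T2 us ss ls"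
      unfolding T using R by (intro sum_nonneg) (auto intro!: mult_nonneg_nonneg T1_nonneg simp del: of_nat_sum)
    ultimately show ?thesis by blast
  qed
qed

section \<open>Ordered set partitions\<close>

definition ordered_partitions :: "'a set \<Rightarrow> 'a set list set" where
  "ordered_partitions A = {Bs. \<Union>(set Bs) = A \<and> (\<forall>B\<in>set Bs. B \<noteq> {}) \<and>
      sorted_wrt (\<lambda>B C. B \<inter> C = {}) Bs}"

lemma ordered_partitions_empty [simp]: "ordered_partitions {} = {[]}"
proof -
  have "Bs = []" if "\<Union>(set Bs) = {}" "\<forall>B\<in>set Bs. B \<noteq> {}" for Bs :: "'a set list"
    using that by (cases Bs) auto
  then show ?thesis by (auto simp: ordered_partitions_def)
qed

text \<open>
  Splitting off the first block; this turns sums over ordered partitions into a recursion over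
  proper subsets.
\<close>

lemma ordered_partitions_rec:
  assumes "A \<noteq> {}"
  shows "ordered_partitions A = (\<lambda>(B, Bs). B # Bs) ` (SIGMA B:{B. B \<subseteq> A \<and> B \<noteq> {}}. ordered_partitions (A - B))"
    (is "_ = ?f ` ?S")
proof (intro equalityI subsetI)
  fix Bs assume Bs: "Bs \<in> ordered_partitions A"
  with assms obtain B Cs where "Bs = B # Cs" by (cases Bs) (auto simp: ordered_partitions_def)
  then have "Bs = ?f (B, Cs)" "(B, Cs) \<in> ?S" using Bs by (auto simp: ordered_partitions_def)
  then show "Bs \<in> ?f ` ?S" by (rule image_eqI)
next
  fix Bs assume "Bs \<in> ?f ` ?S"
  then obtain B Cs where Bs: "Bs = B # Cs" "B \<subseteq> A" "B \<noteq> {}" "Cs \<in> ordered_partitions (A - B)" by auto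
  then have U: "\<Union>(set Cs) = A - B" by (simp add: ordered_partitions_def)
  then have "\<forall>C\<in>set Cs. B \<inter> C = {}" by blast
  moreover have "B \<union> \<Union>(set Cs) = A" using U Bs by blast
  ultimately show "Bs \<in> ordered_partitions A" using Bs by (simp add: ordered_partitions_def)
qed

lemma finite_ordered_partitions:
  assumes "finite A"
  shows "finite (ordered_partitions A)"
  using assms
proof (induction A rule: finite_psubset_induct)
  case (psubset A)
  show ?case
  proof (cases "A = {}")
    case False
    have "finite (SIGMA B:{B. B \<subseteq> A \<and> B \<noteq> {}}. ordered_partitions (A - B))"
      using psubset by (intro finite_SigmaI) auto
    then show ?thesis unfolding ordered_partitions_rec[OF False] by (rule finite_imageI)
  qed simp
qed

lemma sum_nonempty_subsets_by_card:
  fixes g :: "nat \<Rightarrow> real"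
  assumes "finite A"
  shows "(\<Sum>B | B \<subseteq> A \<and> B \<noteq> {}. g (card B)) = (\<Sum>b=1..card A. real (card A choose b) * g b)"
proof -
  let ?P = "{B. B \<subseteq> A \<and> B \<noteq> {}}"
  have "(\<Sum>B\<in>?P. g (card B)) = (\<Sum>b\<in>{1..card A}. \<Sum>B | B \<in> ?P \<and> card B = b. g (card B))"
    using assms by (intro sum.group[symmetric]) (auto simp: card_mono Suc_le_eq card_gt_0_iff finite_subset)
  also have "\<dots> = (\<Sum>b\<in>{1..card A}. real (card A choose b) * g b)"
  proof (intro sum.cong refl)
    fix b assume "b \<in> {1..card A}"
    then have "{B. B \<in> ?P \<and> card B = b} = {B. B \<subseteq> A \<and> card B = b}" by auto
    then show "(\<Sum>B | B \<in> ?P \<and> card B = b. g (card B)) = real (card A choose b) * g b"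
      by (simp add: n_subsets[OF assms])
  qed
  finally show ?thesis .
qed

text \<open>
  The sum counts the ordered partitions with a linear order on every block, that is, the
  permutations of \<open>A\<close> cut into consecutive nonempty pieces; there are \<open>c! * 2 ^ (c - 1)\<close> of them if
  \<open>c = card A > 0\<close>. In the recursion on the first block, after division by \<open>c!\<close>, every size \<open>b\<close> of
  that block contributes the bound \<open>2 ^ (c - b)\<close>.
\<close>

lemma ordered_partitions_weight_le:
  assumes "finite A"
  shows "(\<Sum>Bs\<in>ordered_partitions A. \<Prod>r<length Bs. fact (card (Bs ! r)) :: real) \<le> fact (card A) * 2 ^ card A"
  using assms
proof (induction A rule: finite_psubset_induct)
  case (psubset A)
  show ?case
  proof (cases "A = {}")
    case False
    let ?c = "card A" and ?P = "{B. B \<subseteq> A \<and> B \<noteq> {}}"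
    let ?W = "\<lambda>Bs :: 'a set list. \<Prod>r<length Bs. fact (card (Bs ! r)) :: real"
    have inj: "inj_on (\<lambda>(B, Bs). B # Bs) X" for X :: "('a set \<times> 'a set list) set"
      by (auto simp: inj_on_def)
    have "(\<Sum>Bs\<in>ordered_partitions A. ?W Bs)
        = (\<Sum>(B, Bs)\<in>(SIGMA B:?P. ordered_partitions (A - B)). ?W (B # Bs))"
      unfolding ordered_partitions_rec[OF False] sum.reindex[OF inj] by (simp only: comp_def case_prod_unfold)
    also have "\<dots> = (\<Sum>B\<in>?P. fact (card B) * (\<Sum>Bs\<in>ordered_partitions (A - B). ?W Bs))"
      using psubset.hyps
      by (subst sum.Sigma[symmetric])
         (auto simp: prod.lessThan_Suc_shift sum_distrib_left finite_ordered_partitions simp del: prod.lessThan_Suc)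
    also have "\<dots> \<le> (\<Sum>B\<in>?P. fact (card B) * (fact (?c - card B) * 2 ^ (?c - card B)))"
    proof (intro sum_mono mult_left_mono)
      fix B assume "B \<in> ?P"
      then have "A - B \<subset> A" "card (A - B) = ?c - card B" "finite B"
        using psubset.hyps by (auto simp: card_Diff_subset finite_subset)
      then show "(\<Sum>Bs\<in>ordered_partitions (A - B). ?W Bs) \<le> fact (?c - card B) * 2 ^ (?c - card B)"
        using psubset.IH[of "A - B"] by simp
    qed simp
    also have "\<dots> = (\<Sum>b=1..?c. real (?c choose b) * (fact b * (fact (?c - b) * 2 ^ (?c - b))))"
      by (rule sum_nonempty_subsets_by_card[OF psubset.hyps])
    also have "\<dots> = (\<Sum>b=1..?c. fact ?c * 2 ^ (?c - b))"
      by (intro sum.cong refl) (simp add: binomial_fact)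
    also have "\<dots> = fact ?c * (\<Sum>b<?c. 2 ^ b)"
      unfolding sum_distrib_left
      by (rule sum.reindex_bij_witness[where i = "\<lambda>b. ?c - b" and j = "\<lambda>b. ?c - b"]) auto
    also have "\<dots> \<le> fact ?c * 2 ^ ?c"
    proof (rule mult_left_mono)
      show "(\<Sum>b<?c. 2 ^ b) \<le> (2 :: real) ^ ?c" using sum_gp_strict[of "2::real" ?c] by simp
    qed simp
    finally show ?thesis .
  qed simp
qed

section \<open>The total sum of the numbers $S$\<close>

definition S_factor :: "nat \<Rightarrow> nat \<Rightarrow> nat \<Rightarrow> real" where
  "S_factor s c l = fact (s - 1) / (fact (s + 1 - (c + l)) * fact (l - 1))"

lemma S_factor_nonneg: "0 \<le> S_factor s c l"
  by (simp add: S_factor_def)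

text \<open>
  With \<open>a = c - 1\<close> and \<open>b = l - 1\<close> the summand is \<open>a!\<close> times a trinomial coefficient of \<open>s - 1\<close>, and the
  trinomial coefficients of \<open>s - 1\<close> add up to \<open>3 ^ (s - 1)\<close>.
\<close>

lemma sum_S_factor_le:
  assumes "1 \<le> c" "1 \<le> s"
  shows "(\<Sum>l | 1 \<le> l \<and> c + l \<le> s + 1. S_factor s c l) \<le> 3 ^ s * fact c"
proof (cases "c \<le> s")
  case True
  define a d where "a = c - 1" and "d = s - c"
  have s: "s = Suc (a + d)" and c: "c = Suc a" using assms True by (auto simp: a_def d_def)
  have "(\<Sum>l | 1 \<le> l \<and> c + l \<le> s + 1. S_factor s c l) = (\<Sum>b\<le>d. fact (a + d) / (fact (d - b) * fact b))"
    by (intro sum.reindex_bij_witness[where i = Suc and j = "\<lambda>l. l - 1"])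
       (auto simp: S_factor_def s c)
  also have "\<dots> = (\<Sum>b\<le>d. fact a * real ((a + d) choose a) * real (d choose b))"
    by (intro sum.cong refl) (simp add: binomial_fact)
  also have "\<dots> = fact a * real ((a + d) choose a) * 2 ^ d"
    using choose_row_sum[of d] by (simp add: sum_distrib_left[symmetric] of_nat_sum[symmetric] del: of_nat_sum)
  also have "\<dots> \<le> fact c * 3 ^ s"
  proof -
    have "real ((a + d) choose a) * 2 ^ d \<le> (\<Sum>k\<le>a + d. real ((a + d) choose k) * 2 ^ (a + d - k))"
      using member_le_sum[of a "{..a + d}" "\<lambda>k. real ((a + d) choose k) * 2 ^ (a + d - k)"] by simp
    also have "\<dots> = (1 + 2) ^ (a + d)" by (subst binomial_ring) simp
    also have "\<dots> \<le> (3 :: real) ^ s" by (simp add: s)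
    finally have "real ((a + d) choose a) * 2 ^ d \<le> 3 ^ s" .
    moreover have "(fact a :: real) \<le> fact c" by (rule fact_mono) (simp add: c)
    ultimately show ?thesis unfolding mult.assoc by (intro mult_mono) auto
  qed
  finally show ?thesis by (simp add: mult.commute)
next
  case False
  then have "{l. 1 \<le> l \<and> c + l \<le> s + 1} = {}" by auto
  then show ?thesis by (simp only: sum.empty) simp
qed

text \<open>
  A sum of products over all lists with entries from given sets factorises; this is the
  distributive law for dependent function spaces, transported to lists.
\<close>

lemma sum_lists_prod_le:
  fixes f :: "nat \<Rightarrow> 'a \<Rightarrow> real"
  assumes fin: "\<And>r. r < m \<Longrightarrow> finite (A r)" and f: "\<And>r a. 0 \<le> f r a"
  shows "finite {ls. length ls = m \<and> (\<forall>r<m. ls ! r \<in> A r)}"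
    and "(\<Sum>ls | length ls = m \<and> (\<forall>r<m. ls ! r \<in> A r). \<Prod>r<m. f r (ls ! r)) \<le> (\<Prod>r<m. \<Sum>a\<in>A r. f r a)"
proof -
  let ?L = "{ls. length ls = m \<and> (\<forall>r<m. ls ! r \<in> A r)}"
  let ?h = "\<lambda>ls. \<lambda>r\<in>{..<m}. ls ! r"
  have finP: "finite (PiE {..<m} A)" using fin by (intro finite_PiE) auto
  have inj: "inj_on ?h ?L"
  proof (rule inj_onI)
    fix xs ys assume a: "xs \<in> ?L" "ys \<in> ?L" "?h xs = ?h ys"
    have "xs ! r = ys ! r" if "r < m" for r using fun_cong[OF a(3), of r] that by simp
    then show "xs = ys" using a by (intro nth_equalityI) auto
  qed
  have sub: "?h ` ?L \<subseteq> PiE {..<m} A" unfolding image_subset_iff restrict_PiE_iff by auto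
  show "finite ?L" by (rule inj_on_finite[OF inj sub finP])
  have "(\<Sum>ls\<in>?L. \<Prod>r<m. f r (ls ! r)) = (\<Sum>g\<in>?h ` ?L. \<Prod>r<m. f r (g r))"
    by (subst sum.reindex[OF inj]) (auto intro!: sum.cong prod.cong)
  also have "\<dots> \<le> (\<Sum>g\<in>PiE {..<m} A. \<Prod>r<m. f r (g r))"
    using finP sub f by (intro sum_mono2) (auto intro!: prod_nonneg)
  also have "\<dots> = (\<Prod>r<m. \<Sum>a\<in>A r. f r a)"
    using fin by (intro prod_sum_PiE[symmetric]) auto
  finally show "(\<Sum>ls\<in>?L. \<Prod>r<m. f r (ls ! r)) \<le> (\<Prod>r<m. \<Sum>a\<in>A r. f r a)" .
qed

lemma S_num_nonneg: "0 \<le> S_num vs ss ls"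
  unfolding S_num_def by (intro sum_nonneg prod_nonneg) auto

lemma set_splits_ordered_partitions:
  assumes Bs: "Bs \<in> set_splits m k" and ne: "\<And>r. r < m \<Longrightarrow> Bs ! r \<noteq> {}"
  shows "Bs \<in> ordered_partitions {..<k}"
proof -
  have "\<forall>B\<in>set Bs. B \<noteq> {}" using assms by (auto simp: set_splits_def in_set_conv_nth)
  then show ?thesis using Bs by (auto simp: set_splits_def ordered_partitions_def sorted_wrt_iff_nth_less)
qed

text \<open>
  The upper row is determined by the set partition, its entries being the sums over the blocks. So
  the total is a sum over ordered set partitions and, for each of them, over lower rows. The sum
  over lower rows factorises over the blocks \<open>B\<close> and is at most the product of
  \<open>3 ^ s * (card B)!\<close> by \<open>sum_S_factor_le\<close>, where \<open>s\<close> is the sum over \<open>B\<close>. The powers of 3 multiply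
  up to \<open>3 ^ sum_list vs\<close>, and \<open>ordered_partitions_weight_le\<close> handles the factorials.
\<close>

lemma sum_S_num_le:
  assumes I: "I \<subseteq> {(ss, ls). length ls = length ss \<and> pos_list ss \<and> pos_list ls}" and "finite I"
  shows "(\<Sum>(ss, ls)\<in>I. S_num vs ss ls) \<le> 3 ^ sum_list vs * (fact (length vs) * 2 ^ length vs)"
proof -
  let ?k = "length vs"
  define w where "w = (\<lambda>B. \<Sum>a\<in>B. vs ! a)"
  define L where "L = (\<lambda>Bs. {ls. length ls = length Bs \<and>
      (\<forall>r<length Bs. ls ! r \<in> {l. 1 \<le> l \<and> card (Bs ! r) + l \<le> w (Bs ! r) + 1})})"
  let ?OP = "ordered_partitions {..<?k}"
  let ?M = "\<lambda>ss ls. {Bs. Bs \<in> set_splits (length ss) ?k \<and>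
        (\<forall>r<length ss. (\<Sum>a\<in>Bs ! r. vs ! a) = ss ! r \<and> card (Bs ! r) + ls ! r \<le> ss ! r + 1)}"
  let ?F = "\<lambda>Bs ls. \<Prod>r<length Bs. S_factor (w (Bs ! r)) (card (Bs ! r)) (ls ! r)"
  have finA: "finite {l::nat. 1 \<le> l \<and> c + l \<le> s + 1}" for c s by (rule finite_subset[of _ "{..s + 1}"]) auto
  have finL: "finite (L Bs)" for Bs unfolding L_def by (rule sum_lists_prod_le(1)[where f = "\<lambda>_ _. 0"]) (auto simp: finA[simplified])
  have finOP: "finite ?OP" by (rule finite_ordered_partitions) simp
  have ss_eq: "ss = map w Bs" if "Bs \<in> ?M ss ls" for ss ls Bs
    using that by (intro nth_equalityI) (auto simp: set_splits_def w_def)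
  have OP: "Bs \<in> ?OP" if "Bs \<in> ?M ss ls" "(ss, ls) \<in> I" for ss ls Bs
  proof (rule set_splits_ordered_partitions)
    show "Bs \<in> set_splits (length ss) ?k" using that by simp
    fix r assume r: "r < length ss"
    then have "1 \<le> ss ! r" using that(2) I by (auto simp: pos_list_def)
    moreover have "(\<Sum>a\<in>Bs ! r. vs ! a) = ss ! r" using that(1) r by auto
    ultimately show "Bs ! r \<noteq> {}" by auto
  qed
  have mem: "ls \<in> L Bs" if "Bs \<in> ?M ss ls" "(ss, ls) \<in> I" for ss ls Bs
  proof -
    have "length Bs = length ss" using that by (auto simp: set_splits_def)
    moreover have "length ls = length ss" "pos_list ls" using that I by auto
    ultimately show ?thesis using that(1) by (auto simp: L_def w_def pos_list_def)
  qed
  have finM: "finite (?M ss ls)" if "(ss, ls) \<in> I" for ss ls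
    by (rule finite_subset[OF _ finOP]) (use OP that in blast)
  \<comment> \<open>triples (upper row, lower row, partition) embed into pairs (partition, lower row)\<close>
  let ?T = "SIGMA z:I. ?M (fst z) (snd z)"
  let ?\<phi> = "\<lambda>(z, Bs). (Bs, snd z)"
  have inj: "inj_on ?\<phi> ?T"
  proof (rule inj_onI)
    fix x y assume "x \<in> ?T" "y \<in> ?T" and eq: "?\<phi> x = ?\<phi> y"
    then obtain s l B s' l' B' where xy: "x = ((s, l), B)" "y = ((s', l'), B')" "B \<in> ?M s l" "B' \<in> ?M s' l'"
      by (cases x, cases y) fastforce
    then show "x = y" using eq ss_eq[OF xy(3)] ss_eq[OF xy(4)] by simp
  qed
  have sub: "?\<phi> ` ?T \<subseteq> (SIGMA Bs:?OP. L Bs)"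
    using OP mem by fastforce
  have "(\<Sum>(ss, ls)\<in>I. S_num vs ss ls) = (\<Sum>z\<in>I. \<Sum>Bs\<in>?M (fst z) (snd z). ?F Bs (snd z))"
  proof (intro sum.cong refl, clarify)
    fix ss ls assume "(ss, ls) \<in> I"
    show "S_num vs ss ls = (\<Sum>Bs\<in>?M (fst (ss, ls)) (snd (ss, ls)). ?F Bs (snd (ss, ls)))"
      unfolding S_num_def S_factor_def
      by (intro sum.cong) (auto simp: set_splits_def w_def intro!: prod.cong)
  qed
  also have "\<dots> = (\<Sum>x\<in>?T. ?F (snd x) (snd (fst x)))"
    using \<open>finite I\<close> finM by (subst sum.Sigma) (auto simp: case_prod_unfold)
  also have "\<dots> = (\<Sum>(Bs, ls)\<in>?\<phi> ` ?T. ?F Bs ls)"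
    by (subst sum.reindex[OF inj]) (auto simp: case_prod_unfold)
  also have "\<dots> \<le> (\<Sum>(Bs, ls)\<in>(SIGMA Bs:?OP. L Bs). ?F Bs ls)"
    using sub finOP finL by (intro sum_mono2) (auto intro!: prod_nonneg S_factor_nonneg)
  also have "\<dots> = (\<Sum>Bs\<in>?OP. \<Sum>ls\<in>L Bs. ?F Bs ls)"
    using finOP finL by (intro sum.Sigma[symmetric]) auto
  also have "\<dots> \<le> (\<Sum>Bs\<in>?OP. 3 ^ sum_list vs * (\<Prod>r<length Bs. fact (card (Bs ! r))))"
  proof (intro sum_mono)
    fix Bs assume Bs: "Bs \<in> ?OP"
    have fB: "finite (Bs ! r)" "Bs ! r \<noteq> {}" if "r < length Bs" for r
      using Bs nth_mem[OF that] by (auto simp: ordered_partitions_def intro: finite_subset[of _ "{..<?k}"])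
    have tot: "(\<Sum>r<length Bs. w (Bs ! r)) = sum_list vs"
    proof -
      have "(\<Union>r<length Bs. Bs ! r) = {..<?k}"
      proof -
        have "(\<Union>r<length Bs. Bs ! r) = \<Union>(set Bs)" unfolding set_conv_nth by blast
        then show ?thesis using Bs by (simp add: ordered_partitions_def)
      qed
      moreover have "(\<Sum>a\<in>(\<Union>r<length Bs. Bs ! r). vs ! a) = (\<Sum>r<length Bs. w (Bs ! r))"
        unfolding w_def
      proof (rule sum.UNION_disjoint)
        have "Bs ! i \<inter> Bs ! j = {}" if "i < j" "j < length Bs" for i j
          using Bs that by (auto simp: ordered_partitions_def sorted_wrt_iff_nth_less)
        then show "\<forall>i\<in>{..<length Bs}. \<forall>j\<in>{..<length Bs}. i \<noteq> j \<longrightarrow> Bs ! i \<inter> Bs ! j = {}"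
          by (metis Int_commute lessThan_iff linorder_neqE_nat)
      qed (use fB in auto)
      ultimately show ?thesis by (simp add: sum_list_sum_nth atLeast0LessThan)
    qed
    have "(\<Sum>ls\<in>L Bs. ?F Bs ls) \<le>
        (\<Prod>r<length Bs. \<Sum>l | 1 \<le> l \<and> card (Bs ! r) + l \<le> w (Bs ! r) + 1. S_factor (w (Bs ! r)) (card (Bs ! r)) l)"
      unfolding L_def by (rule sum_lists_prod_le(2)[OF finA S_factor_nonneg])
    also have "\<dots> \<le> (\<Prod>r<length Bs. 3 ^ w (Bs ! r) * fact (card (Bs ! r)))"
    proof (intro prod_mono conjI sum_nonneg S_factor_nonneg)
      fix r assume r: "r \<in> {..<length Bs}"
      have c: "1 \<le> card (Bs ! r)" using fB[of r] r by (simp add: Suc_le_eq card_gt_0_iff)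
      show "(\<Sum>l | 1 \<le> l \<and> card (Bs ! r) + l \<le> w (Bs ! r) + 1. S_factor (w (Bs ! r)) (card (Bs ! r)) l)
          \<le> 3 ^ w (Bs ! r) * fact (card (Bs ! r))"
      proof (cases "1 \<le> w (Bs ! r)")
        case True
        then show ?thesis by (rule sum_S_factor_le[OF c])
      next
        case False
        then have "{l. 1 \<le> l \<and> card (Bs ! r) + l \<le> w (Bs ! r) + 1} = {}" using c by auto
        then show ?thesis by (simp only: sum.empty) simp
      qed
    qed
    also have "\<dots> = 3 ^ sum_list vs * (\<Prod>r<length Bs. fact (card (Bs ! r)))"
      by (simp add: prod.distrib power_sum[symmetric] tot)
    finally show "(\<Sum>ls\<in>L Bs. ?F Bs ls) \<le> 3 ^ sum_list vs * (\<Prod>r<length Bs. fact (card (Bs ! r)))" .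
  qed
  also have "\<dots> = 3 ^ sum_list vs * (\<Sum>Bs\<in>?OP. \<Prod>r<length Bs. fact (card (Bs ! r)))"
    by (simp add: sum_distrib_left)
  also have "\<dots> \<le> 3 ^ sum_list vs * (fact ?k * 2 ^ ?k)"
    using ordered_partitions_weight_le[of "{..<?k}"] by (intro mult_left_mono) auto
  finally show ?thesis .
qed

section \<open>The coefficients $N^1$\<close>

lemma pos_list_length_le: "pos_list xs \<Longrightarrow> length xs \<le> sum_list xs"
  by (induction xs) (auto simp: pos_list_def)

lemma sum_list_le_length_mult:
  fixes xs :: "nat list"
  shows "(\<And>x. x \<in> set xs \<Longrightarrow> x \<le> n) \<Longrightarrow> sum_list xs \<le> n * length xs"
  by (induction xs) (auto simp: add_mono)

text \<open>
  The closed formulas for \<open>N1\<close> with a single index on one side are, up to the harmless shift by one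
  in the denominator, summands of the sum in \<open>sum_S_factor_le\<close>.
\<close>

lemma falling_factorial_le:
  assumes "1 \<le> c" "c \<le> i"
  shows "fact (i - 1) / fact (i + 1 - c) \<le> (3 ^ i * fact c :: real)"
proof -
  have "fact (i - 1) / fact (i + 1 - c) \<le> (fact (i - 1) / fact (i - c) :: real)"
    using assms by (intro divide_left_mono fact_mono) auto
  also have "\<dots> = S_factor i c 1" using assms by (simp add: S_factor_def)
  also have "\<dots> \<le> (\<Sum>l | 1 \<le> l \<and> c + l \<le> i + 1. S_factor i c l)"
  proof (rule member_le_sum[of 1 _ "S_factor i c"])
    show "finite {l. 1 \<le> l \<and> c + l \<le> i + 1}" by (rule finite_subset[of _ "{..i + 1}"]) auto
  qed (use assms in \<open>auto simp: S_factor_nonneg\<close>)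
  also have "\<dots> \<le> 3 ^ i * fact c" using assms by (intro sum_S_factor_le) auto
  finally show ?thesis .
qed

text \<open>
  The signs in \<open>N1\<close> are ignored: \<open>T2\<close> is bounded uniformly by \<open>T2_bounds\<close>, and the remaining sum of
  the \<open>S_num\<close> by \<open>sum_S_num_le\<close>. The power \<open>3 ^ i\<close> is absorbed because
  \<open>3 < 2 * e\<close> and \<open>i\<close> is at most \<open>n\<close> times the number of indices, on either side.
\<close>

lemma abs_N1_le:
  fixes n :: nat
  defines "E \<equiv> (2 * exp 1) ^ n"
  assumes us: "us \<noteq> []" "\<And>u. u \<in> set us \<Longrightarrow> 1 \<le> u \<and> u \<le> n"
    and vs: "vs \<noteq> []" "\<And>v. v \<in> set vs \<Longrightarrow> 1 \<le> v \<and> v \<le> n"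
  shows "\<bar>N1 i us vs\<bar> \<le> fact (length us) * (real n * E) ^ length us * (fact (length vs) * (2 * E) ^ length vs)"
    (is "_ \<le> ?R")
proof (cases "i = sum_list us \<and> i = sum_list vs")
  case False
  then have "N1 i us vs = 0" by (simp add: N1_def)
  then show ?thesis by (simp add: E_def)
next
  case True
  let ?k = "length us" and ?k' = "length vs"
  have pos: "pos_list us" "pos_list vs" using us vs by (auto simp: pos_list_def)
  have k: "1 \<le> ?k" "1 \<le> ?k'" using us vs by (auto simp: Suc_le_eq)
  have n: "1 \<le> n" using us by (metis last_in_set order_trans)
  have ki: "?k \<le> i" "?k' \<le> i" using pos[THEN pos_list_length_le] True by auto
  have in_us: "i \<le> n * ?k" using True us(2) sum_list_le_length_mult[of us n] by auto
  have in_vs: "i \<le> n * ?k'" using True vs(2) sum_list_le_length_mult[of vs n] by auto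
  have three: "3 ^ n \<le> E"
    unfolding E_def using exp_ge_add_one_self[of 1] by (intro power_mono) auto
  have E1: "1 \<le> E" using three one_le_power[of "3::real" n] by linarith
  have nE: "E \<le> real n * E" using E1 n mult_right_mono[of 1 "real n" E] by simp
  with E1 have nE1: "1 \<le> real n * E" by linarith
  have three_i: "3 ^ i \<le> E ^ c" if "i \<le> n * c" for c
  proof -
    have "(3::real) ^ i \<le> 3 ^ (n * c)" using that by (intro power_increasing) auto
    also have "\<dots> = (3 ^ n) ^ c" by (rule power_mult)
    also have "\<dots> \<le> E ^ c" using three by (intro power_mono) auto
    finally show ?thesis .
  qed
  have E2: "E ^ c \<le> (2 * E) ^ c" for c using E1 by (intro power_mono) simp_all
  have E2': "1 \<le> (2 * E) ^ c" for c using E1 by (intro one_le_power) simp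
  have En: "E ^ c \<le> (real n * E) ^ c" for c using E1 nE by (intro power_mono) simp_all
  have En': "1 \<le> (real n * E) ^ c" for c using nE1 by (intro one_le_power)
  have L1: "1 \<le> fact ?k * (real n * E) ^ ?k" and R1: "1 \<le> fact ?k' * (2 * E) ^ ?k'"
    using mult_mono[OF fact_ge_1 En'[of ?k], of ?k] mult_mono[OF fact_ge_1 E2'[of ?k'], of ?k'] by simp_all
  consider "?k = 1" | "?k \<noteq> 1" "?k' = 1" | "?k \<ge> 2" "?k' \<noteq> 1" using k by linarith
  then show ?thesis
  proof cases
    case 1
    have "\<bar>N1 i us vs\<bar> = fact (i - 1) / fact (i + 1 - ?k')"
      using True 1 by (simp add: N1_def)
    also have "\<dots> \<le> 3 ^ i * fact ?k'" by (rule falling_factorial_le[OF k(2) ki(2)])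
    also have "\<dots> \<le> (2 * E) ^ ?k' * fact ?k'"
      using three_i[OF in_vs] E2[of ?k'] by (intro mult_right_mono) auto
    also have "\<dots> \<le> ?R" using mult_right_mono[OF L1, of "(2 * E) ^ ?k' * fact ?k'"] R1 by (simp add: mult_ac)
    finally show ?thesis .
  next
    case 2
    have "\<bar>N1 i us vs\<bar> = fact (i - 1) / fact (i + 1 - ?k)"
      using True 2 by (simp add: N1_def)
    also have "\<dots> \<le> 3 ^ i * fact ?k" by (rule falling_factorial_le[OF k(1) ki(1)])
    also have "\<dots> \<le> (real n * E) ^ ?k * fact ?k"
      using three_i[OF in_us] En[of ?k] by (intro mult_right_mono) auto
    also have "\<dots> \<le> ?R" using mult_left_mono[OF R1, of "(real n * E) ^ ?k * fact ?k"] L1 by (simp add: mult_ac)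
    finally show ?thesis .
  next
    case 3
    let ?I = "{(ss, ls). ss \<noteq> [] \<and> length ls = length ss \<and> pos_list ss \<and> pos_list ls \<and>
              sum_list ss = sum_list us \<and> sum_list ls = length ss + length us - 2}"
    let ?M = "fact ?k * (real n * E) ^ ?k"
    have "?I \<subseteq> {xs. set xs \<subseteq> {..i + ?k} \<and> length xs \<le> i} \<times> {xs. set xs \<subseteq> {..i + ?k} \<and> length xs \<le> i}"
    proof (rule subsetI)
      fix z assume "z \<in> ?I"
      then obtain ss ls where z: "z = (ss, ls)" and a: "length ls = length ss" "pos_list ss"
          "sum_list ss = sum_list us" "sum_list ls = length ss + length us - 2"
        by auto
      then have "length ss \<le> i" "sum_list ss = i" "sum_list ls \<le> i + ?k"
        using pos_list_length_le[of ss] True by auto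
      then show "z \<in> {xs. set xs \<subseteq> {..i + ?k} \<and> length xs \<le> i} \<times> {xs. set xs \<subseteq> {..i + ?k} \<and> length xs \<le> i}"
        using z a(1) by (auto dest!: member_le_sum_list)
    qed
    then have fI: "finite ?I" by (rule finite_subset) (simp add: finite_lists_length_le)
    have T: "0 \<le> T2 us ss ls \<and> T2 us ss ls \<le> ?M" if "(ss, ls) \<in> ?I" for ss ls
    proof -
      have l: "length ls = length ss" "pos_list ls" "sum_list ls = length ss + ?k - 2" using that by auto
      have ge1: "1 \<le> ls ! r" if "r < length ss" for r
        using l that nth_mem[of r ls] by (simp add: pos_list_def)
      have "(\<Sum>r<length ss. ls ! r - 1) + (\<Sum>r<length ss. 1) = (\<Sum>r<length ss. ls ! r)"
        unfolding sum.distrib[symmetric] by (intro sum.cong refl le_add_diff_inverse2 ge1) simp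
      also have "\<dots> = length ss + ?k - 2" using l by (simp add: sum_list_sum_nth atLeast0LessThan)
      finally have "(\<Sum>r<length ss. ls ! r - 1) = ?k - 2" using 3 by simp
      then have "0 \<le> T2 us ss ls \<and> T2 us ss ls \<le> fact (?k - 2) * (real n * E) ^ (?k - 1)"
        unfolding E_def using 3 us l by (intro T2_bounds) auto
      moreover have "fact (?k - 2) * (real n * E) ^ (?k - 1) \<le> ?M"
        using nE1 by (intro mult_mono fact_mono power_increasing) auto
      ultimately show ?thesis by linarith
    qed
    have "\<bar>N1 i us vs\<bar> = \<bar>\<Sum>(ss, ls)\<in>?I. (-1) ^ (length ss + 1) * S_num vs ss ls * T2 us ss ls\<bar>"
      using True 3 by (simp add: N1_def)
    also have "\<dots> \<le> (\<Sum>(ss, ls)\<in>?I. S_num vs ss ls * ?M)"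
    proof (rule order_trans[OF sum_abs], intro sum_mono, clarify)
      fix ss ls
      assume "ss \<noteq> []" "length ls = length ss" "pos_list ss" "pos_list ls"
        "sum_list ss = sum_list us" "sum_list ls = length ss + length us - 2"
      then have "0 \<le> T2 us ss ls \<and> T2 us ss ls \<le> ?M" by (intro T) auto
      then show "\<bar>(-1) ^ (length ss + 1) * S_num vs ss ls * T2 us ss ls\<bar> \<le> S_num vs ss ls * ?M"
        using S_num_nonneg[of vs ss ls] by (simp add: abs_mult power_abs mult_left_mono)
    qed
    also have "\<dots> = (\<Sum>(ss, ls)\<in>?I. S_num vs ss ls) * ?M"
      by (simp add: sum_distrib_right case_prod_unfold)
    also have "\<dots> \<le> (3 ^ sum_list vs * (fact ?k' * 2 ^ ?k')) * ?M"
      using fI L1 by (intro mult_right_mono sum_S_num_le) auto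
    also have "\<dots> \<le> (E ^ ?k' * (fact ?k' * 2 ^ ?k')) * ?M"
      using three_i[OF in_vs] True L1 by (intro mult_right_mono) auto
    finally show ?thesis by (simp add: power_mult_distrib mult_ac)
  qed
qed

section \<open>Convergence of the series\<close>

lemma with_mult_simps [simp]:
  "with_mult [] ns = []" "with_mult (u # us) (k # ns) = replicate k u @ with_mult us ns"
  by (auto simp: with_mult_def)

lemma length_with_mult: "length us = length ns \<Longrightarrow> length (with_mult us ns) = sum_list ns"
  by (induction us ns rule: list_induct2) auto

lemma set_with_mult: "length us = length ns \<Longrightarrow> set (with_mult us ns) \<subseteq> set us"
  by (induction us ns rule: list_induct2) auto

lemma prod_powers_le:
  fixes a :: "nat \<Rightarrow> real"
  assumes "\<And>r. r < length ns \<Longrightarrow> 0 \<le> a r \<and> a r \<le> c"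
  shows "(\<Prod>r<length ns. a r ^ (ns ! r)) \<le> c ^ sum_list ns"
proof -
  have "(\<Prod>r<length ns. a r ^ (ns ! r)) \<le> (\<Prod>r<length ns. c ^ (ns ! r))"
    using assms by (intro prod_mono) (auto intro!: power_mono)
  then show ?thesis by (simp add: power_sum[symmetric] sum_list_sum_nth atLeast0LessThan)
qed

definition increasing_lists :: "nat \<Rightarrow> nat list set" where
  "increasing_lists n = {us. sorted_wrt (<) us \<and> set us \<subseteq> {1..n}}"

lemma length_increasing_lists: "us \<in> increasing_lists n \<Longrightarrow> length us \<le> n"
  using card_mono[of "{1..n}" "set us"]
  by (auto simp: increasing_lists_def strict_sorted_iff distinct_card)

lemma finite_increasing_lists: "finite (increasing_lists n)"
proof (rule finite_subset)
  show "increasing_lists n \<subseteq> {us. set us \<subseteq> {1..n} \<and> length us \<le> n}"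
    using length_increasing_lists by (auto simp: increasing_lists_def)
qed (simp add: finite_lists_length_le)

text \<open>
  A multinomial coefficient times a power of a ratio small enough that the sum over all
  multiplicities of at most \<open>n\<close> different indices converges like \<open>\<Sum>\<^sub>K (1 / 2) ^ K\<close>.
\<close>

definition multinomial_weight :: "nat \<Rightarrow> nat list \<Rightarrow> real" where
  "multinomial_weight n ns = fact (sum_list ns) * (\<Prod>r<length ns. 1 / fact (ns ! r)) * (1 / (2 * real n)) ^ sum_list ns"

lemma multinomial_weight_nonneg: "0 \<le> multinomial_weight n ns"
  by (auto simp: multinomial_weight_def intro!: mult_nonneg_nonneg prod_nonneg)

text \<open>
  There are only finitely many increasing lists of indices. For one such list of length \<open>d \<le> n\<close> the
  multinomial coefficients of total \<open>K\<close> add up to \<open>d ^ K\<close>, so that the sum over \<open>K\<close> is dominated by a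
  geometric series of ratio \<open>1 / 2\<close>.
\<close>

lemma sum_multinomial_weight_le:
  assumes n: "1 \<le> n" and G: "finite G" "G \<subseteq> {(us, ns). us \<in> increasing_lists n \<and> length ns = length us}"
  shows "(\<Sum>(us, ns)\<in>G. multinomial_weight n ns) \<le> 2 * real (card (increasing_lists n))"
proof -
  let ?U = "increasing_lists n"
  let ?A = "\<lambda>d K. {ns :: nat list. length ns = d \<and> sum_list ns = K}"
  define N where "N = (\<Sum>(us, ns)\<in>G. sum_list ns)"
  have N: "sum_list ns \<le> N" if "(us, ns) \<in> G" for us ns
    using member_le_sum[of "(us, ns)" G "\<lambda>(us, ns). sum_list ns"] that G by (simp add: N_def)
  have "G \<subseteq> (SIGMA us:?U. \<Union>K\<le>N. ?A (length us) K)"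
    using G N by fastforce
  then have "(\<Sum>(us, ns)\<in>G. multinomial_weight n ns)
      \<le> (\<Sum>(us, ns)\<in>(SIGMA us:?U. \<Union>K\<le>N. ?A (length us) K). multinomial_weight n ns)"
    by (intro sum_mono2)
       (auto simp: multinomial_weight_nonneg finite_increasing_lists finite_lists_sum_eq)
  also have "\<dots> = (\<Sum>us\<in>?U. \<Sum>ns\<in>(\<Union>K\<le>N. ?A (length us) K). multinomial_weight n ns)"
    by (intro sum.Sigma[symmetric]) (auto simp: finite_increasing_lists finite_lists_sum_eq)
  also have "\<dots> \<le> (\<Sum>us\<in>?U. 2)"
  proof (intro sum_mono)
    fix us assume us: "us \<in> ?U"
    let ?d = "length us"
    have "(\<Sum>ns\<in>(\<Union>K\<le>N. ?A ?d K). multinomial_weight n ns) = (\<Sum>K\<le>N. \<Sum>ns\<in>?A ?d K. multinomial_weight n ns)"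
      by (rule sum.UNION_disjoint) (auto simp: finite_lists_sum_eq)
    also have "\<dots> = (\<Sum>K\<le>N. (fact K * (1 / (2 * real n)) ^ K) * (\<Sum>ns\<in>?A ?d K. \<Prod>r<?d. 1 / fact (ns ! r)))"
      unfolding sum_distrib_left by (intro sum.cong refl) (auto simp: multinomial_weight_def)
    also have "\<dots> = (\<Sum>K\<le>N. (real ?d / (2 * real n)) ^ K)"
      by (intro sum.cong refl) (simp add: multinomial_exponential_sum power_divide)
    also have "\<dots> \<le> (\<Sum>K\<le>N. (1 / 2) ^ K)"
      using n length_increasing_lists[OF us] by (intro sum_mono power_mono) (auto simp: field_simps)
    also have "\<dots> \<le> 2"
    proof -
      have "S \<le> 2" if "(1 - 1 / 2) * S = 1 - y" "0 \<le> y" for S y :: real using that by simp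
      from this[OF sum_gp_basic] show ?thesis by simp
    qed
    finally show "(\<Sum>ns\<in>(\<Union>K\<le>N. ?A ?d K). multinomial_weight n ns) \<le> 2" .
  qed
  finally show ?thesis by simp
qed

theorem theorem3:
  fixes n :: nat and t0 :: real and t tb :: "nat \<Rightarrow> complex"
  assumes "n \<ge> 1"
    and "\<And>i. i > n \<Longrightarrow> t i = 0 \<and> tb i = 0"
    and "0 < t0" and "t0 < 1"
    and "\<And>i. 1 \<le> i \<Longrightarrow> i \<le> n \<Longrightarrow>
           norm (t i) \<le> inverse (4 * real n ^ 3 * 2 ^ n * exp (real n)) \<and>
           norm (tb i) \<le> inverse (4 * real n ^ 3 * 2 ^ n * exp (real n))"
  shows "\<exists>F. toda_series_has_value t0 t tb F"
proof -
  define E where "E = (2 * exp (1::real)) ^ n"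
  define w where "w = inverse (4 * real n ^ 3 * E)"
  have E0: "0 < E" by (simp add: E_def)
  have n0: "0 < real n" using assms(1) by simp
  have w0: "0 < w" using E0 n0 by (simp add: w_def)
  have wE: "inverse (4 * real n ^ 3 * 2 ^ n * exp (real n)) = w"
    using exp_of_nat_mult[of n "1::real"] by (simp add: w_def E_def power_mult_distrib mult_ac)
  have ratio1: "real n * w * (real n * E) \<le> 1 / (2 * real n)"
    using n0 E0 by (simp add: w_def field_simps power3_eq_cube)
  have ratio2: "real n * w * (2 * E) \<le> 1 / (2 * real n)"
    using n0 E0 assms(1) by (simp add: w_def field_simps power3_eq_cube)
  let ?X = "{(us, ns :: nat list). us \<in> increasing_lists n \<and> length ns = length us}"
  let ?h = "multinomial_weight n"
  let ?H = "\<lambda>y :: (nat list \<times> nat list) \<times> (nat list \<times> nat list). ?h (snd (fst y)) * ?h (snd (snd y))"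
  \<comment> \<open>outside \<open>good\<close> the terms vanish; on \<open>good\<close> the index \<open>i\<close> is determined by the rest, so the projection \<open>\<pi>\<close> is injective there\<close>
  define good where "good = {(i, us, ns, vs, ms). (us, ns) \<in> ?X \<and> (vs, ms) \<in> ?X \<and> i = sum_list (with_mult us ns)}"
  define \<pi> where "\<pi> = (\<lambda>(i :: nat, us :: nat list, ns :: nat list, vs :: nat list, ms :: nat list). ((us, ns), (vs, ms)))"

  \<comment> \<open>the share of the unbarred indices (with \<open>c = n * E\<close>) and that of the barred ones (with \<open>c = 2 * E\<close>)\<close>
  have half: "norm (\<Prod>r<length us. of_nat (us ! r) ^ (ns ! r) / fact (ns ! r) :: complex) *
        norm (\<Prod>r<length us. \<tau> (us ! r) ^ (ns ! r)) * (fact (sum_list ns) * c ^ sum_list ns) \<le> ?h ns"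
    if X: "(us, ns) \<in> ?X" and \<tau>: "\<And>i. 1 \<le> i \<Longrightarrow> i \<le> n \<Longrightarrow> norm (\<tau> i) \<le> w"
      and c: "0 \<le> c" "real n * w * c \<le> 1 / (2 * real n)" for us ns :: "nat list" and \<tau> :: "nat \<Rightarrow> complex" and c
  proof -
    let ?K = "sum_list ns" and ?D = "\<Prod>r<length ns. 1 / fact (ns ! r) :: real"
    have len: "length us = length ns" using X by simp
    have bd: "1 \<le> us ! r \<and> us ! r \<le> n" if "r < length ns" for r
    proof -
      have "us ! r \<in> set us" using that len by simp
      then have "us ! r \<in> {1..n}" using X by (auto simp: increasing_lists_def)
      then show ?thesis by simp
    qed
    have D0: "0 \<le> ?D" by (intro prod_nonneg) auto
    have "norm (\<Prod>r<length us. of_nat (us ! r) ^ (ns ! r) / fact (ns ! r) :: complex)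
        = (\<Prod>r<length ns. real (us ! r) ^ (ns ! r)) * ?D"
      by (simp add: len prod_norm[symmetric] norm_divide norm_power prod.distrib[symmetric])
    also have "\<dots> \<le> real n ^ ?K * ?D"
      using bd D0 by (intro mult_right_mono prod_powers_le) auto
    finally have 1: "norm (\<Prod>r<length us. of_nat (us ! r) ^ (ns ! r) / fact (ns ! r) :: complex) \<le> real n ^ ?K * ?D" .
    have "norm (\<Prod>r<length us. \<tau> (us ! r) ^ (ns ! r)) = (\<Prod>r<length ns. norm (\<tau> (us ! r)) ^ (ns ! r))"
      by (simp add: len prod_norm[symmetric] norm_power)
    also have "\<dots> \<le> w ^ ?K" using bd \<tau> by (intro prod_powers_le) auto
    finally have 2: "norm (\<Prod>r<length us. \<tau> (us ! r) ^ (ns ! r)) \<le> w ^ ?K" .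
    have "norm (\<Prod>r<length us. of_nat (us ! r) ^ (ns ! r) / fact (ns ! r) :: complex) *
        norm (\<Prod>r<length us. \<tau> (us ! r) ^ (ns ! r)) * (fact ?K * c ^ ?K)
        \<le> (real n ^ ?K * ?D) * w ^ ?K * (fact ?K * c ^ ?K)"
      using c w0 D0 by (intro mult_right_mono mult_mono[OF 1 2]) auto
    also have "\<dots> = fact ?K * ?D * (real n * w * c) ^ ?K"
      by (simp add: power_mult_distrib mult_ac)
    also have "\<dots> \<le> ?h ns"
      unfolding multinomial_weight_def using c n0 w0 D0 by (intro mult_left_mono power_mono) auto
    finally show ?thesis .
  qed

  have bound: "norm (toda_term t0 t tb x) \<le> ?H (\<pi> x)"
    if "x \<in> toda_index" "x \<in> good" for x
  proof -
    obtain i us ns vs ms where x: "x = (i, us, ns, vs, ms)" by (cases x) auto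
    let ?K = "sum_list ns" and ?K' = "sum_list ms"
    have X: "(us, ns) \<in> ?X" "(vs, ms) \<in> ?X" using that by (auto simp: x good_def)
    have idx: "us \<noteq> []" "length ns = length us" "pos_list ns" "vs \<noteq> []" "length ms = length vs" "pos_list ms"
      using that(1) by (auto simp: x toda_index_def)
    have ne: "with_mult zs ks \<noteq> []" if "zs \<noteq> []" "length ks = length zs" "pos_list ks" for zs ks
    proof -
      have "length zs \<le> sum_list ks" using that pos_list_length_le[of ks] by simp
      moreover have "0 < length zs" using that by simp
      ultimately have "length (with_mult zs ks) \<noteq> 0"
        using that by (simp only: length_with_mult[OF that(2)[symmetric]])
      then show ?thesis unfolding length_0_conv .
    qed
    have lens: "length (with_mult us ns) = ?K" "length (with_mult vs ms) = ?K'"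
      using idx by (simp_all add: length_with_mult)
    have N: "\<bar>N2 i us ns vs ms\<bar> \<le> fact ?K * (real n * E) ^ ?K * (fact ?K' * (2 * E) ^ ?K')"
      unfolding N2_def E_def lens[symmetric]
    proof (rule abs_N1_le)
      show "1 \<le> u \<and> u \<le> n" if "u \<in> set (with_mult us ns)" for u
        using set_with_mult[of us ns] X that by (auto simp: increasing_lists_def)
      show "1 \<le> v \<and> v \<le> n" if "v \<in> set (with_mult vs ms)" for v
        using set_with_mult[of vs ms] X that by (auto simp: increasing_lists_def)
    qed (use ne idx in auto)
    let ?a = "norm (\<Prod>r<length us. of_nat (us ! r) ^ (ns ! r) / fact (ns ! r) :: complex)"
    let ?b = "norm (\<Prod>r<length vs. of_nat (vs ! r) ^ (ms ! r) / fact (ms ! r) :: complex)"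
    let ?c = "norm (\<Prod>r<length us. t (us ! r) ^ (ns ! r))"
    let ?d = "norm (\<Prod>r<length vs. tb (vs ! r) ^ (ms ! r))"
    have "norm (toda_term t0 t tb x) = (?a * ?b * ?c * ?d) * \<bar>N2 i us ns vs ms\<bar> * t0 ^ (i + 2 - (?K + ?K'))"
      unfolding x toda_term_def using assms(3) by (simp only: prod.case norm_mult norm_power norm_of_real) (simp add: mult_ac)
    \<comment> \<open>here \<open>0 < t0\<close> and \<open>t0 < 1\<close> enter\<close>
    also have "\<dots> \<le> (?a * ?b * ?c * ?d) * \<bar>N2 i us ns vs ms\<bar> * 1"
      using assms(3,4) by (intro mult_left_mono power_le_one) auto
    also have "\<dots> \<le> (?a * ?b * ?c * ?d) * (fact ?K * (real n * E) ^ ?K * (fact ?K' * (2 * E) ^ ?K'))"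
      unfolding mult_1_right by (intro mult_left_mono N) auto
    also have "\<dots> = (?a * ?c * (fact ?K * (real n * E) ^ ?K)) * (?b * ?d * (fact ?K' * (2 * E) ^ ?K'))"
      by (simp only: mult_ac)
    also have "\<dots> \<le> ?h ns * ?h ms"
      using assms(5) E0 n0 unfolding wE
      by (intro mult_mono half X ratio1 ratio2 multinomial_weight_nonneg) auto
    finally show ?thesis by (simp add: \<pi>_def x)
  qed

  have zero: "toda_term t0 t tb x = 0" if mem: "x \<in> toda_index" "x \<notin> good" for x
  proof -
    obtain i us ns vs ms where x: "x = (i, us, ns, vs, ms)" by (cases x) auto
    have vanish: "(\<Prod>r<length zs. \<tau> (zs ! r) ^ (ks ! r)) = 0"
      if out: "\<not> set zs \<subseteq> {1..n}" and pz: "pos_list zs" and ks: "pos_list ks" "length ks = length zs" and \<tau>: "\<And>i. n < i \<Longrightarrow> \<tau> i = 0"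
      for zs ks :: "nat list" and \<tau> :: "nat \<Rightarrow> complex"
    proof -
      obtain z where "z \<in> set zs" "z \<notin> {1..n}" using out by blast
      with pz obtain r where r: "r < length zs" "n < zs ! r"
        by (auto simp: pos_list_def in_set_conv_nth)
      have "1 \<le> ks ! r" using ks r nth_mem[of r ks] by (simp add: pos_list_def)
      then have "\<tau> (zs ! r) ^ (ks ! r) = 0" using \<tau>[OF r(2)] by (simp add: power_0_left)
      then show ?thesis using r(1) by (intro prod_zero) auto
    qed
    consider "\<not> set us \<subseteq> {1..n}" | "\<not> set vs \<subseteq> {1..n}" | "i \<noteq> sum_list (with_mult us ns)"
      using mem by (auto simp: x toda_index_def good_def increasing_lists_def)
    then show ?thesis
    proof cases
      case 1
      then have "(\<Prod>r<length us. t (us ! r) ^ (ns ! r)) = 0"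
        using mem(1) assms(2) by (intro vanish) (auto simp: x toda_index_def)
      then show ?thesis unfolding x toda_term_def prod.case by (simp only: mult_zero_left mult_zero_right)
    next
      case 2
      then have "(\<Prod>r<length vs. tb (vs ! r) ^ (ms ! r)) = 0"
        using mem(1) assms(2) by (intro vanish) (auto simp: x toda_index_def)
      then show ?thesis unfolding x toda_term_def prod.case by (simp only: mult_zero_left mult_zero_right)
    next
      case 3
      then have "N2 i us ns vs ms = 0" by (simp add: N2_def N1_def)
      then show ?thesis by (simp add: x toda_term_def)
    qed
  qed

  have inj: "inj_on \<pi> good" by (auto simp: inj_on_def \<pi>_def good_def)
  let ?C = "2 * real (card (increasing_lists n))"
  have "(\<lambda>x. norm (toda_term t0 t tb x)) summable_on toda_index"
  proof (rule nonneg_bdd_above_summable_on)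
    show "bdd_above (sum (\<lambda>x. norm (toda_term t0 t tb x)) ` {F. F \<subseteq> toda_index \<and> finite F})"
    proof (rule bdd_aboveI2)
      fix F assume F: "F \<in> {F. F \<subseteq> toda_index \<and> finite F}"
      let ?G = "\<pi> ` (F \<inter> good)"
      have fG: "finite ?G" using F by auto
      have GX: "fst ` ?G \<subseteq> ?X" "snd ` ?G \<subseteq> ?X" by (auto simp: \<pi>_def good_def)
      have "(\<Sum>x\<in>F. norm (toda_term t0 t tb x)) = (\<Sum>x\<in>F \<inter> good. norm (toda_term t0 t tb x))"
      proof (rule sum.mono_neutral_right)
        show "\<forall>x\<in>F - F \<inter> good. norm (toda_term t0 t tb x) = 0"
          unfolding norm_eq_zero using F zero by blast
      qed (use F in auto)
      also have "\<dots> \<le> (\<Sum>x\<in>F \<inter> good. ?H (\<pi> x))"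
      proof (rule sum_mono)
        fix x assume "x \<in> F \<inter> good"
        then have "x \<in> toda_index" "x \<in> good" using F by auto
        then show "norm (toda_term t0 t tb x) \<le> ?H (\<pi> x)" by (rule bound)
      qed
      also have "\<dots> = (\<Sum>y\<in>?G. ?H y)"
        using inj by (subst sum.reindex) (auto intro: inj_on_subset)
      also have "\<dots> \<le> (\<Sum>y\<in>fst ` ?G \<times> snd ` ?G. ?H y)"
      proof (rule sum_mono2)
        show "finite (fst ` ?G \<times> snd ` ?G)" using fG by blast
        show "?G \<subseteq> fst ` ?G \<times> snd ` ?G" by (rule subset_fst_snd)
      qed (auto intro!: mult_nonneg_nonneg multinomial_weight_nonneg)
      also have "\<dots> = (\<Sum>(us, ns)\<in>fst ` ?G. ?h ns) * (\<Sum>(vs, ms)\<in>snd ` ?G. ?h ms)"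
        unfolding sum_product sum.cartesian_product case_prod_unfold ..
      also have "\<dots> \<le> ?C * ?C"
        using fG GX assms(1)
        by (intro mult_mono sum_multinomial_weight_le finite_imageI[OF fG] sum_nonneg)
           (auto simp: multinomial_weight_nonneg)
      finally show "(\<Sum>x\<in>F. norm (toda_term t0 t tb x)) \<le> ?C * ?C" .
    qed
  qed simp
  then have "toda_term t0 t tb summable_on toda_index" by (rule abs_summable_summable)
  then have "(toda_term t0 t tb has_sum infsum (toda_term t0 t tb) toda_index) toda_index" by (rule has_sum_infsum)
  then show ?thesis unfolding toda_series_has_value_def by blast
qed

end
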